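(* (1) For each $\lambda\in\mathbb N$, the set $\{\mathfrak t_{\mathrm{ev}}^{(n)} v^+_{2\lambda}\mid 0\le n\le 2\lambda\}$ forms the $\imath$-canonical basis for $L(2\lambda)$. Moreover, $\mathfrak t_{\mathrm{ev}}^{(n)} v^+_{2\lambda}=0$ for $n>2\lambda$. (2) The set $\{\mathfrak t_{\mathrm{ev}}^{(n)}\mid n\in\mathbb N\}$ forms the $\imath$-canonical basis for $\mathbf U^\imath$ (of even parity, i.e. relative to the modules $L(2\lambda)$, $\lambda\in\mathbb N$).
   Context: $\mathbb N=\{0,1,2,\dots\}$. $\mathbf U=\mathbf U_q(\mathfrak{sl}_2)$ is the $\mathbb Q(q)$-algebra generated by $E,F,K,K^{-1}$ with relations $KK^{-1}=K^{-1}K=1$, $EF-FE=\frac{K-K^{-1}}{q-q^{-1}}$, $KE=q^2EK$, $KF=q^{-2}FK$. For $n\in\mathbb Z$, $[n]=\frac{q^n-q^{-n}}{q-q^{-1}}$, and $[n]!=[1]\cdots[n]$ for $n\ge 0$; $F^{(n)}=F^n/[n]!$. Put $\check E=q^{-1}EK^{-1}$ and $\mathfrak t=\check E+F$. Here $\mathbf U^\imath$ is the $\mathbb Q(q)$-subalgebra of $\mathbf U$ generated by $\mathfrak t$ (a polynomial algebra in $\mathfrak t$). The $\imath$-divided powers are $\mathfrak t_{\mathrm{ev}}^{(0)}=1$, $\mathfrak t_{\mathrm{ev}}^{(2a)}=\frac{1}{[2a]!}\,\mathfrak t\prod_{i=1-a}^{a-1}(\mathfrak t-[2i])$ for $a\ge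 1$, and $\mathfrak t_{\mathrm{ev}}^{(2a+1)}=\frac{1}{[2a+1]!}\prod_{i=-a}^{a}(\mathfrak t-[2i])$ for $a\ge 0$. For $\mu\in\mathbb N$, $L(\mu)$ is the simple $\mathbf U$-module of highest weight $\mu$ (dimension $\mu+1$) with highest weight vector $v^+_\mu$ (so $Ev^+_\mu=0$, $Kv^+_\mu=q^\mu v^+_\mu$); it has canonical basis $\{F^{(a)}v^+_\mu\mid 0\le a\le\mu\}$. For $\mu=2\lambda$, the bar involution $\psi_\imath$ on $L(\mu)$ is the $\mathbb Q$-linear map with $\psi_\imath(qx)=q^{-1}\psi_\imath(x)$ that fixes $\mathfrak t_{\mathrm{ev}}^{(n)}v^+_\mu$ for all $n\ge 0$ (equivalently, fixes $\mathfrak t^n v^+_\mu$ for all $n\ge 0$). The $\imath$-canonical basis $\{b^\mu_a\}_{0\le a\le\mu}$ of $L(\mu)$ is the basis characterized by: (i) $\psi_\imath(b^\mu_a)=b^\mu_a$; (ii) $b^\mu_a\in F^{(a)}v^+_\mu+\sum_{0\le r\le\mu}q^{-1}\mathbb Z[q^{-1}]F^{(r)}v^+_\mu$. The $\imath$-canonical basis for $\mathbf U^\imath$ of even parity is the set $\{u_a\mid a\in\mathbb N\}$ where $u_a\in\mathbf U^\imath$ is the unique element with $u_a v^+_{2\lambda}=b^{2\lambda}_a$ for all sufficiently large $\lambda\in\mathbb N$. *)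

theory Defs
  imports
    "HOL-Computational_Algebra.Computational_Algebra"
    "HOL-Library.FuncSet"
begin

type_synonym Qq = "rat poly fract"

definition qq :: Qq where
  "qq = Fract [:0, 1:] 1"

definition Qq_of_rat :: "rat \<Rightarrow> Qq" where
  "Qq_of_rat c = Fract [:c:] 1"

definition qint :: "int \<Rightarrow> Qq" where
  "qint n = (qq powi n - qq powi (- n)) / (qq - inverse qq)"

definition qfact :: "nat \<Rightarrow> Qq" where
  "qfact n = (\<Prod>k = 1..n. qint (int k))"

definition qinv_Zqinv :: "Qq set" where
  "qinv_Zqinv = {inverse qq * poly (map_poly of_int p) (inverse qq) | p :: int poly. True}"

text \<open>Terms of the signature of unital algebras over \<open>\<rat>(q)\<close> with four named generators;
  \<open>UConst c\<close> is the multiple \<open>c\<cdot>1\<close> of the unit.\<close>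

datatype uterm =
  UE | UF | UK | UKinv | UConst Qq | UAdd uterm uterm | UMul uterm uterm

text \<open>The smallest congruence that satisfies the axioms of an associative unital
  \<open>\<rat>(q)\<close>-algebra (first two groups of rules) and the defining relations (last group).\<close>

inductive ueq :: "uterm \<Rightarrow> uterm \<Rightarrow> bool" where
  refl: "ueq x x"
| sym: "ueq x y \<Longrightarrow> ueq y x"
| trans: "ueq x y \<Longrightarrow> ueq y z \<Longrightarrow> ueq x z"
| cong_add: "ueq x x' \<Longrightarrow> ueq y y' \<Longrightarrow> ueq (UAdd x y) (UAdd x' y')"
| cong_mul: "ueq x x' \<Longrightarrow> ueq y y' \<Longrightarrow> ueq (UMul x y) (UMul x' y')"

| add_assoc: "ueq (UAdd (UAdd x y) z) (UAdd x (UAdd y z))"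
| add_comm: "ueq (UAdd x y) (UAdd y x)"
| add_zero: "ueq (UAdd (UConst 0) x) x"
| add_neg: "ueq (UAdd (UMul (UConst (- 1)) x) x) (UConst 0)"
| mul_assoc: "ueq (UMul (UMul x y) z) (UMul x (UMul y z))"
| mul_one_left: "ueq (UMul (UConst 1) x) x"
| mul_one_right: "ueq (UMul x (UConst 1)) x"
| distrib_left: "ueq (UMul x (UAdd y z)) (UAdd (UMul x y) (UMul x z))"
| distrib_right: "ueq (UMul (UAdd x y) z) (UAdd (UMul x z) (UMul y z))"
| const_add: "ueq (UConst (c + d)) (UAdd (UConst c) (UConst d))"
| const_mul: "ueq (UConst (c * d)) (UMul (UConst c) (UConst d))"
| const_central: "ueq (UMul (UConst c) x) (UMul x (UConst c))"

| K_Kinv: "ueq (UMul UK UKinv) (UConst 1)"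
| Kinv_K: "ueq (UMul UKinv UK) (UConst 1)"
| E_F: "ueq (UAdd (UMul UE UF) (UMul (UConst (-1)) (UMul UF UE)))
    (UMul (UConst (1 / (qq - inverse qq))) (UAdd UK (UMul (UConst (-1)) UKinv)))"
| K_E: "ueq (UMul UK UE) (UMul (UConst (qq\<^sup>2)) (UMul UE UK))"
| K_F: "ueq (UMul UK UF) (UMul (UConst (inverse (qq\<^sup>2))) (UMul UF UK))"

quotient_type Uq = uterm / ueq
  by (intro equivpI reflpI sympI transpI) (blast intro: ueq.refl ueq.sym ueq.trans)+

lift_definition gE :: Uq is UE .
lift_definition gF :: Uq is UF .
lift_definition gK :: Uq is UK .
lift_definition gKinv :: Uq is UKinv .

lift_definition scalar :: "Qq \<Rightarrow> Uq" is UConst .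

(* The trivial representation; it shows that 0 and 1 are not congruent. *)
primrec counit :: "uterm \<Rightarrow> Qq" where
  "counit UE = 0"
| "counit UF = 0"
| "counit UK = 1"
| "counit UKinv = 1"
| "counit (UConst c) = c"
| "counit (UAdd x y) = counit x + counit y"
| "counit (UMul x y) = counit x * counit y"

lemma counit_cong: "ueq x y \<Longrightarrow> counit x = counit y"
  by (induction rule: ueq.induct) (simp_all add: algebra_simps)

instantiation Uq :: ring_1
begin

lift_definition zero_Uq :: Uq is "UConst 0" .
lift_definition one_Uq :: Uq is "UConst 1" .
lift_definition plus_Uq :: "Uq \<Rightarrow> Uq \<Rightarrow> Uq" is UAdd by (rule ueq.cong_add)
lift_definition times_Uq :: "Uq \<Rightarrow> Uq \<Rightarrow> Uq" is UMul by (rule ueq.cong_mul)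
lift_definition uminus_Uq :: "Uq \<Rightarrow> Uq" is "\<lambda>x. UMul (UConst (- 1)) x"
  by (intro ueq.cong_mul ueq.refl)
lift_definition minus_Uq :: "Uq \<Rightarrow> Uq \<Rightarrow> Uq" is
  "\<lambda>x y. UAdd x (UMul (UConst (- 1)) y)"
  by (intro ueq.cong_add ueq.cong_mul ueq.refl)

instance
proof
  fix a b c :: Uq
  show "a + b + c = a + (b + c)" by transfer (rule ueq.add_assoc)
  show "a + b = b + a" by transfer (rule ueq.add_comm)
  show "0 + a = a" by transfer (rule ueq.add_zero)
  show "- a + a = 0" by transfer (rule ueq.add_neg)
  show "a - b = a + - b" by transfer (rule ueq.refl)
  show "a * b * c = a * (b * c)" by transfer (rule ueq.mul_assoc)
  show "1 * a = a" by transfer (rule ueq.mul_one_left)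
  show "a * 1 = a" by transfer (rule ueq.mul_one_right)
  show "a * (b + c) = a * b + a * c" by transfer (rule ueq.distrib_left)
  show "(a + b) * c = a * c + b * c" by transfer (rule ueq.distrib_right)
  show "(0 :: Uq) \<noteq> 1" by transfer (auto dest: counit_cong)
qed

end

definition Echeck :: Uq where
  "Echeck = scalar (inverse qq) * gE * gKinv"

definition tt :: Uq where
  "tt = Echeck + gF"

inductive_set Ui :: "Uq set" where
  tt: "tt \<in> Ui"
| scalar: "scalar c \<in> Ui"
| add: "x \<in> Ui \<Longrightarrow> y \<in> Ui \<Longrightarrow> x + y \<in> Ui"
| mult: "x \<in> Ui \<Longrightarrow> y \<in> Ui \<Longrightarrow> x * y \<in> Ui"

(* The factors commute, so the order of the list does not matter. *)
definition tt_prod :: "int \<Rightarrow> int \<Rightarrow> Uq" where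
  "tt_prod l u = (\<Prod>i\<leftarrow>[l..u]. tt - scalar (qint (2 * i)))"

definition tev :: "nat \<Rightarrow> Uq" where
  "tev n =
    (let a = n div 2 in
     if n = 0 then 1
     else if even n then scalar (1 / qfact n) * tt * tt_prod (1 - int a) (int a - 1)
     else scalar (1 / qfact n) * tt_prod (- int a) (int a))"

definition Fdiv :: "nat \<Rightarrow> Uq" where
  "Fdiv n = scalar (1 / qfact n) * gF ^ n"

text \<open>A module is carried by a subspace \<open>V\<close> of an ambient \<open>\<rat>(q)\<close>-vector space.  The ambient space
  carries no action; it only allows modules of different dimensions to live in one type.\<close>

locale Uq_module = vector_space scale
  for scale :: "Qq \<Rightarrow> 'v::ab_group_add \<Rightarrow> 'v" +
  fixes V :: "'v set" and act :: "Uq \<Rightarrow> 'v \<Rightarrow> 'v"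
  assumes subspace_carrier: "subspace V"
    and act_closed: "x \<in> V \<Longrightarrow> act u x \<in> V"
    and act_add_right: "x \<in> V \<Longrightarrow> y \<in> V \<Longrightarrow> act u (x + y) = act u x + act u y"
    and act_add_left: "x \<in> V \<Longrightarrow> act (u + w) x = act u x + act w x"
    and act_mult: "x \<in> V \<Longrightarrow> act (u * w) x = act u (act w x)"
    and act_scalar: "x \<in> V \<Longrightarrow> act (scalar c) x = scale c x"
begin

definition submodule :: "'v set \<Rightarrow> bool" where
  "submodule W \<longleftrightarrow> subspace W \<and> W \<subseteq> V \<and> (\<forall>u. \<forall>x\<in>W. act u x \<in> W)"

end

locale simple_hw_module = Uq_module scale V act
  for scale :: "Qq \<Rightarrow> 'v::ab_group_add \<Rightarrow> 'v" and V act +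
  fixes \<mu> :: nat and vp :: 'v
  assumes vp_in: "vp \<in> V"
    and vp_nonzero: "vp \<noteq> 0"
    and act_E_vp: "act gE vp = 0"
    and act_K_vp: "act gK vp = scale (qq ^ \<mu>) vp"
    and simple: "submodule W \<Longrightarrow> W = {0} \<or> W = V"
begin

definition is_bar_involution :: "('v \<Rightarrow> 'v) \<Rightarrow> bool" where
  "is_bar_involution \<psi> \<longleftrightarrow>
     \<psi> \<in> V \<rightarrow>\<^sub>E V \<and>
     (\<forall>x\<in>V. \<forall>y\<in>V. \<psi> (x + y) = \<psi> x + \<psi> y) \<and>
     (\<forall>c. \<forall>x\<in>V. \<psi> (scale (Qq_of_rat c) x) = scale (Qq_of_rat c) (\<psi> x)) \<and>
     (\<forall>x\<in>V. \<psi> (scale qq x) = scale (inverse qq) (\<psi> x)) \<and>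
     (\<forall>n. \<psi> (act (tev n) vp) = act (tev n) vp)"

text \<open>Meaningful for even \<open>\<mu>\<close> only.  The functions \<open>\<psi>\<close> above and \<open>b\<close> below are extensional, so that they are
  determined by their values on \<open>V\<close> and \<open>{..\<mu>}\<close> and the definite descriptions are well defined.\<close>

definition bar_involution :: "'v \<Rightarrow> 'v" where
  "bar_involution = (THE \<psi>. is_bar_involution \<psi>)"

definition is_icanonical_basis :: "(nat \<Rightarrow> 'v) \<Rightarrow> bool" where
  "is_icanonical_basis b \<longleftrightarrow>
     b \<in> {..\<mu>} \<rightarrow>\<^sub>E V \<and>
     inj_on b {..\<mu>} \<and> independent (b ` {..\<mu>}) \<and> span (b ` {..\<mu>}) = V \<and>
     (\<forall>a\<le>\<mu>. bar_involution (b a) = b a) \<and>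
     (\<forall>a\<le>\<mu>. \<exists>c. (\<forall>r\<le>\<mu>. c r \<in> qinv_Zqinv) \<and>
        b a = act (Fdiv a) vp + (\<Sum>r\<le>\<mu>. scale (c r) (act (Fdiv r) vp)))"

definition icanonical_basis :: "nat \<Rightarrow> 'v" where
  "icanonical_basis = (THE b. is_icanonical_basis b)"

end

text \<open>In the next definition \<open>V \<mu>\<close>, \<open>act \<mu>\<close>, \<open>vp \<mu>\<close> are the carrier, the action and the
  highest weight vector of the simple module of highest weight \<open>\<mu>\<close>.\<close>

definition Ui_icanonical_basis ::
  "(Qq \<Rightarrow> 'v::ab_group_add \<Rightarrow> 'v) \<Rightarrow> (nat \<Rightarrow> 'v set) \<Rightarrow> (nat \<Rightarrow> Uq \<Rightarrow> 'v \<Rightarrow> 'v) \<Rightarrow> (nat \<Rightarrow> 'v)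
    \<Rightarrow> nat \<Rightarrow> Uq" where
  "Ui_icanonical_basis scale V act vp a =
    (THE u. u \<in> Ui \<and>
      (\<forall>\<^sub>F l in sequentially. act (2 * l) u (vp (2 * l)) =
        simple_hw_module.icanonical_basis scale (V (2 * l)) (act (2 * l)) (2 * l) (vp (2 * l)) a))"

text \<open>The assumptions of \<open>simple_hw_module\<close> are satisfiable for all highest weights at once, with
  all carriers in one type: polynomials of degree at most \<open>\<mu>\<close>, where the monomial of degree \<open>a\<close> plays the role of
  \<open>F\<^sup>(\<^sup>a\<^sup>)\<close> applied to the highest weight vector.\<close>

lemma qq_power: "qq ^ n = Fract (monom 1 n) 1"
proof (induction n)
  case 0
  show ?case by (simp add: One_fract_def)
next
  case (Suc n)
  have "qq = Fract (monom 1 1) 1" by (simp add: qq_def monom_Suc monom_0 one_pCons)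
  then have "qq ^ Suc n = Fract (monom 1 1) 1 * Fract (monom 1 n) 1"
    by (simp only: power_Suc Suc.IH)
  then show ?case by (simp add: mult_monom)
qed

lemma qq_nonzero: "qq \<noteq> 0"
  unfolding qq_def Zero_fract_def by (simp add: eq_fract)

lemma qq_power_neq_1: "n > 0 \<Longrightarrow> qq ^ n \<noteq> 1"
  unfolding qq_power One_fract_def by (simp add: eq_fract monom_eq_1_iff)

lemma qq_minus_inverse: "qq - inverse qq \<noteq> 0"
  using qq_power_neq_1[of 2] qq_nonzero by (auto simp: field_simps power2_eq_square)

lemma qint_0: "qint 0 = 0"
  by (simp add: qint_def)

lemma qint_nonzero: assumes "n > 0" shows "qint n \<noteq> 0"
proof
  assume "qint n = 0"
  then have "qq powi n = qq powi (- n)"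
    using qq_minus_inverse by (simp add: qint_def)
  then have "qq powi n * qq powi n = qq powi (- n) * qq powi n" by simp
  then have "qq powi (n + n) = 1"
    using qq_nonzero by (simp flip: power_int_add)
  moreover have "n + n = int (nat (n + n))" using assms by simp
  ultimately have "qq ^ nat (n + n) = 1" by (metis power_int_of_nat)
  with qq_power_neq_1[of "nat (n + n)"] assms show False by simp
qed

lemma qint_comm:
  "qint (m - b) * qint (b + 1) - qint b * qint (m - b + 1) = qint (m - 2 * b)"
proof -
  define A B where "A = qq powi m" and "B = qq powi b"
  have [simp]: "A \<noteq> 0" "B \<noteq> 0" "qq \<noteq> 0" using qq_nonzero by (simp_all add: A_def B_def)
  have e: "qq powi (m - b) = A / B" "qq powi (- (m - b)) = B / A"
    "qq powi (b + 1) = B * qq" "qq powi (- (b + 1)) = 1 / (B * qq)"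
    "qq powi (- b) = 1 / B" "qq powi b = B"
    "qq powi (m - b + 1) = A * qq / B" "qq powi (- (m - b + 1)) = B / (A * qq)"
    "qq powi (m - 2 * b) = A / (B * B)" "qq powi (- (m - 2 * b)) = B * B / A"
    by (simp_all add: A_def B_def power_int_add power_int_diff power_int_minus field_simps
          power_int_mult power2_eq_square mult_2 del: minus_add_distrib)
  show ?thesis
    unfolding qint_def e using qq_minus_inverse
    apply (simp add: divide_simps)
    apply (simp add: algebra_simps)
    done
qed

definition mkp :: "nat \<Rightarrow> (nat \<Rightarrow> Qq) \<Rightarrow> Qq poly" where
  "mkp \<mu> g = (\<Sum>b\<le>\<mu>. monom (g b) b)"

lemma coeff_mkp: "coeff (mkp \<mu> g) n = (if n \<le> \<mu> then g n else 0)"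
  unfolding mkp_def coeff_sum by (simp add: sum.delta)

primrec Lev :: "nat \<Rightarrow> uterm \<Rightarrow> Qq poly \<Rightarrow> Qq poly" where
  "Lev \<mu> UE p = mkp \<mu> (\<lambda>b. qint (int \<mu> - int b) * coeff p (Suc b))"
| "Lev \<mu> UF p = mkp \<mu> (\<lambda>b. qint (int b) * coeff p (b - 1))"
| "Lev \<mu> UK p = mkp \<mu> (\<lambda>b. qq powi (int \<mu> - 2 * int b) * coeff p b)"
| "Lev \<mu> UKinv p = mkp \<mu> (\<lambda>b. qq powi (2 * int b - int \<mu>) * coeff p b)"
| "Lev \<mu> (UConst c) p = smult c p"
| "Lev \<mu> (UAdd x y) p = Lev \<mu> x p + Lev \<mu> y p"
| "Lev \<mu> (UMul x y) p = Lev \<mu> x (Lev \<mu> y p)"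

definition Lc :: "nat \<Rightarrow> Qq poly set" where "Lc \<mu> = {p. \<forall>n>\<mu>. coeff p n = 0}"

lemma mkp_in_Lc [simp]: "mkp \<mu> g \<in> Lc \<mu>"
  by (simp add: Lc_def coeff_mkp)

lemma Lev_closed: "p \<in> Lc \<mu> \<Longrightarrow> Lev \<mu> x p \<in> Lc \<mu>"
  by (induction x arbitrary: p) (simp_all, simp_all add: Lc_def)

lemma Lev_add: "Lev \<mu> x (p + r) = Lev \<mu> x p + Lev \<mu> x r"
proof (induction x arbitrary: p r)
  case (UMul x y)
  then show ?case by simp
qed (auto intro!: poly_eqI simp: coeff_mkp algebra_simps smult_add_right)

lemma Lev_smult: "Lev \<mu> x (smult c p) = smult c (Lev \<mu> x p)"
proof (induction x arbitrary: p)
  case (UMul x y)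
  then show ?case by simp
qed (auto intro!: poly_eqI simp: coeff_mkp algebra_simps)

lemma Lev_cong: "ueq x y \<Longrightarrow> p \<in> Lc \<mu> \<Longrightarrow> Lev \<mu> x p = Lev \<mu> y p"
proof (induction arbitrary: p rule: ueq.induct)
  case (cong_mul x x' y y')
  then show ?case by (simp add: Lev_closed)
next
  case (K_Kinv) then show ?case using qq_nonzero
    by (auto simp: poly_eq_iff coeff_mkp Lc_def simp flip: mult.assoc power_int_add)
next
  case (Kinv_K) then show ?case using qq_nonzero
    by (auto simp: poly_eq_iff coeff_mkp Lc_def simp flip: mult.assoc power_int_add)
next
  case (E_F)
  have *: "qint (int \<mu> - int n) * (qint (int n + 1) * coeff p n) -
      qint (int n) * (qint (int \<mu> - int n + 1) * coeff p n) = qint (int \<mu> - 2 * int n) * coeff p n"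
    for n using qint_comm[of "int \<mu>" "int n"] by (simp add: algebra_simps flip: distrib_right)
  show ?case
  proof (rule poly_eqI)
    fix n
    show "coeff (Lev \<mu> (UAdd (UMul UE UF) (UMul (UConst (-1)) (UMul UF UE))) p) n =
      coeff (Lev \<mu> (UMul (UConst (1 / (qq - inverse qq))) (UAdd UK (UMul (UConst (-1)) UKinv))) p) n"
    proof (cases "n \<le> \<mu>")
      case True
      have l: "coeff (Lev \<mu> (UMul UE UF) p) n = qint (int \<mu> - int n) * (qint (int n + 1) * coeff p n)"
        using True by (auto simp: coeff_mkp qint_0 add.commute dest: le_neq_implies_less)
      have r: "coeff (Lev \<mu> (UMul UF UE) p) n = qint (int n) * (qint (int \<mu> - int n + 1) * coeff p n)"
        using True by (cases n) (auto simp: coeff_mkp qint_0)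
      have "coeff (Lev \<mu> (UAdd (UMul UE UF) (UMul (UConst (-1)) (UMul UF UE))) p) n =
          coeff (Lev \<mu> (UMul UE UF) p) n - coeff (Lev \<mu> (UMul UF UE) p) n"
        by simp
      also have "\<dots> = qint (int \<mu> - 2 * int n) * coeff p n"
        unfolding l r by (rule *)
      also have "\<dots> = coeff (Lev \<mu> (UMul (UConst (1 / (qq - inverse qq)))
          (UAdd UK (UMul (UConst (-1)) UKinv))) p) n"
        using True by (simp add: qint_def coeff_mkp flip: left_diff_distrib)
      finally show ?thesis .
    qed (simp add: coeff_mkp)
  qed
next
  case (K_E)
  have *: "qq\<^sup>2 * qq powi (int \<mu> - 2 * int (Suc n)) = qq powi (int \<mu> - 2 * int n)" for n
    using power_int_add[of qq 2 "int \<mu> - 2 * int (Suc n)"] qq_nonzero by (simp add: algebra_simps)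
  show ?case
  proof (rule poly_eqI)
    fix n
    show "coeff (Lev \<mu> (UMul UK UE) p) n =
      coeff (Lev \<mu> (UMul (UConst (qq\<^sup>2)) (UMul UE UK)) p) n"
      using K_E *[of n]
      by (cases "Suc n \<le> \<mu>") (auto simp: coeff_mkp Lc_def mult.left_commute simp flip: mult.assoc)
  qed
next
  case (K_F)
  have *: "qq\<^sup>2 * qq powi (int \<mu> - 2 * int (Suc n)) = qq powi (int \<mu> - 2 * int n)" for n
    using power_int_add[of qq 2 "int \<mu> - 2 * int (Suc n)"] qq_nonzero by (simp add: algebra_simps)
  have *: "inverse (qq\<^sup>2) * qq powi (int \<mu> - 2 * int n) = qq powi (int \<mu> - 2 * int (Suc n))" for n
    unfolding *[of n, symmetric] using qq_nonzero by simp
  show ?case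
  proof (rule poly_eqI)
    fix n
    show "coeff (Lev \<mu> (UMul UK UF) p) n =
      coeff (Lev \<mu> (UMul (UConst (inverse (qq\<^sup>2))) (UMul UF UK)) p) n"
    proof (cases n)
      case (Suc m)
      show ?thesis unfolding Suc Lev.simps coeff_mkp coeff_smult using *[of m]
        by (simp del: of_nat_Suc add: mult.left_commute flip: mult.assoc)
    qed (simp add: coeff_mkp qint_0)
  qed
qed (simp_all add: Lev_add Lev_smult smult_add_left add_ac Lev_closed mult.commute)

definition Lact :: "nat \<Rightarrow> Uq \<Rightarrow> Qq poly \<Rightarrow> Qq poly" where
  "Lact \<mu> u = Lev \<mu> (rep_Uq u)"

lemma Lact_abs: "p \<in> Lc \<mu> \<Longrightarrow> Lact \<mu> (abs_Uq x) p = Lev \<mu> x p"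
  unfolding Lact_def
  by (rule Lev_cong) (auto simp: Quotient3_rep_abs[OF Quotient3_Uq] ueq.refl)

lemma Uq_abs_cases: obtains x where "u = abs_Uq x"
  by (metis Quotient3_abs_rep[OF Quotient3_Uq])

lemma vector_space_smult: "vector_space (smult :: Qq \<Rightarrow> Qq poly \<Rightarrow> Qq poly)"
  by unfold_locales (simp_all add: smult_add_right smult_add_left)

lemma Lc_module: "Uq_module smult (Lc \<mu>) (Lact \<mu>)"
proof -
  interpret vector_space "smult :: Qq \<Rightarrow> Qq poly \<Rightarrow> Qq poly" by (rule vector_space_smult)
  show ?thesis
  proof
    show "subspace (Lc \<mu>)" by (auto simp: subspace_def Lc_def)
  next
    fix x u assume "x \<in> Lc \<mu>" then show "Lact \<mu> u x \<in> Lc \<mu>" by (simp add: Lact_def Lev_closed)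
  next
    fix x y u show "Lact \<mu> u (x + y) = Lact \<mu> u x + Lact \<mu> u y" by (simp add: Lact_def Lev_add)
  next
    fix x u w assume x: "x \<in> Lc \<mu>"
    obtain u' w' where "u = abs_Uq u'" "w = abs_Uq w'" by (metis Uq_abs_cases)
    with x show "Lact \<mu> (u + w) x = Lact \<mu> u x + Lact \<mu> w x"
      "Lact \<mu> (u * w) x = Lact \<mu> u (Lact \<mu> w x)"
      by (simp_all add: plus_Uq.abs_eq times_Uq.abs_eq Lact_abs Lev_closed)
  next
    fix x c assume "x \<in> Lc \<mu>" then show "Lact \<mu> (scalar c) x = smult c x"
      by (simp add: scalar.abs_eq Lact_abs)
  qed
qed

theorem simple_hw_module_exists:
  "simple_hw_module smult (Lc \<mu>) (Lact \<mu>) \<mu> 1"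
proof -
  interpret Uq_module smult "Lc \<mu>" "Lact \<mu>" by (rule Lc_module)
  have one: "1 \<in> Lc \<mu>" by (simp add: Lc_def)
  have E: "coeff (Lact \<mu> gE p) n = (if n \<le> \<mu> then qint (int \<mu> - int n) * coeff p (Suc n) else 0)"
    if "p \<in> Lc \<mu>" for p n using that by (simp add: gE.abs_eq Lact_abs coeff_mkp)
  have F: "coeff (Lact \<mu> gF p) n = (if n \<le> \<mu> then qint (int n) * coeff p (n - 1) else 0)"
    if "p \<in> Lc \<mu>" for p n using that by (simp add: gF.abs_eq Lact_abs coeff_mkp)
  have K: "coeff (Lact \<mu> gK p) n = (if n \<le> \<mu> then qq powi (int \<mu> - 2 * int n) * coeff p n else 0)"
    if "p \<in> Lc \<mu>" for p n using that by (simp add: gK.abs_eq Lact_abs coeff_mkp)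
  show ?thesis
  proof unfold_locales
    show "1 \<in> Lc \<mu>" by (rule one)
    show "(1 :: Qq poly) \<noteq> 0" by simp
    show "Lact \<mu> gE 1 = 0" by (simp add: poly_eq_iff E[OF one])
    show "Lact \<mu> gK 1 = smult (qq ^ \<mu>) 1" by (auto simp: poly_eq_iff K[OF one] coeff_pCons split: nat.splits)
  next
    fix W assume W: "submodule W"
    then have sub: "subspace W" and WL: "W \<subseteq> Lc \<mu>" and act: "\<And>u x. x \<in> W \<Longrightarrow> Lact \<mu> u x \<in> W"
      by (auto simp: submodule_def)
    have one_W: "\<exists>c\<noteq>0. [:c:] \<in> W" if "p \<in> W" "p \<noteq> 0" "degree p = n" for p n
      using that
    proof (induction n arbitrary: p)
      case 0
      then show ?case by (metis degree_eq_zeroE pCons_0_0)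
    next
      case (Suc n)
      have p: "p \<in> Lc \<mu>" using Suc WL by auto
      have c: "coeff p (Suc n) \<noteq> 0" using Suc by (metis leading_coeff_0_iff)
      with p have le: "Suc n \<le> \<mu>" by (auto simp: Lc_def not_le[symmetric])
      have "coeff (Lact \<mu> gE p) n \<noteq> 0"
        using c le qint_nonzero[of "int \<mu> - int n"] by (simp add: E[OF p])
      moreover have "coeff (Lact \<mu> gE p) m = 0" if "m > n" for m
        using that Suc.prems by (simp add: E[OF p] coeff_eq_0)
      ultimately have "degree (Lact \<mu> gE p) = n"
        by (intro antisym degree_le le_degree) auto
      moreover have "Lact \<mu> gE p \<noteq> 0" using \<open>coeff (Lact \<mu> gE p) n \<noteq> 0\<close> by auto
      ultimately show ?case using Suc.IH act[OF Suc.prems(1)] by blast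
    qed
    show "W = {0} \<or> W = Lc \<mu>"
    proof (cases "W \<subseteq> {0}")
      case True
      then show ?thesis using subspace_0[OF sub] by auto
    next
      case False
      then obtain c where c: "c \<noteq> 0" "[:c:] \<in> W" using one_W by blast
      have scale_W: "monom d n \<in> W" if "monom e n \<in> W" "e \<noteq> 0" for d e n
        using subspace_scale[OF sub that(1), of "d / e"] that(2) by (simp add: smult_monom)
      have mon: "monom d n \<in> W" if "n \<le> \<mu>" for n d
        using that
      proof (induction n arbitrary: d)
        case 0
        then show ?case using c scale_W[of c 0] by (simp add: monom_0)
      next
        case (Suc n)
        have m: "monom 1 n \<in> W" using Suc by simp
        have "Lact \<mu> gF (monom 1 n) = monom (qint (int (Suc n))) (Suc n)"
        proof (rule poly_eqI)
          fix k show "coeff (Lact \<mu> gF (monom 1 n)) k = coeff (monom (qint (int (Suc n))) (Suc n)) k"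
            using Suc.prems m WL by (cases k) (auto simp: F subset_iff qint_0)
        qed
        then have "monom (qint (int (Suc n))) (Suc n) \<in> W" using act[OF m] by metis
        then show ?case using scale_W qint_nonzero by simp
      qed
      have "p \<in> W" if "p \<in> Lc \<mu>" for p
      proof -
        have "p = (\<Sum>n\<le>\<mu>. monom (coeff p n) n)"
          using that by (auto simp: poly_eq_iff coeff_sum sum.delta Lc_def)
        then show ?thesis using mon subspace_sum[OF sub] by (metis (no_types, lifting) atMost_iff)
      qed
      then show ?thesis using WL by auto
    qed
  qed
qed

end

theory Submission
  imports Defs
begin

text \<open>
  The reason for the theorem is a closed formula.  Write \<open>w\<^sub>k\<close> for \<open>F\<^sup>(\<^sup>k\<^sup>)\<close> applied to the highest weight vector
  of highest weight \<open>\<mu> = 2 l\<close>.  Then \<open>tt\<close> acts as a three-term operator,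
  \<open>tt w\<^sub>k = [k + 1] w\<^sub>k\<^sub>+\<^sub>1 + q\<^bsup>2 k - 1 - \<mu>\<^esup> [\<mu> - k + 1] w\<^sub>k\<^sub>-\<^sub>1\<close>,
  and the divided powers satisfy the recursion
  \<open>tt tev(2 a + 1) = [2 a + 2] tev(2 a + 2)\<close> and
  \<open>tt tev(2 a) = [2 a + 1] tev(2 a + 1) + [2 a] tev(2 a - 1)\<close>, the last term being absent
  for \<open>a = 0\<close>.  With \<open>G(N, c)\<close> the Gaussian binomial
  coefficient \<open>(N + c choose c)\<close> in the variable \<open>q\<^sup>-\<^sup>4\<close>, the solution of the recursion on the highest weight
  vector is that \<open>tev(2 m)\<close> acts by the sum of \<open>q\<^bsup>-c (2 c - 1)\<^esup> G(l - m, c) w\<^bsub>2 m - 2 c\<^esub>\<close>, and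
  \<open>tev(2 m + 1)\<close> by the sum of \<open>q\<^bsup>-c (2 c + 1)\<^esup> G(l - m - 1, c) w\<^bsub>2 m + 1 - 2 c\<^esub>\<close>, over all \<open>c\<close>
  (\<open>act_tev_expansion\<close>).

  Everything can be read off from this formula.  The coefficient of \<open>c = 0\<close> is \<open>1\<close>.  In degree
  at most \<open>\<mu>\<close>, the parameter \<open>N\<close> of \<open>G\<close> is a natural number, so \<open>G\<close> is a polynomial in \<open>q\<^sup>-\<^sup>4\<close> with
  integer coefficients, and the power of \<open>q\<close> in front of it puts all coefficients with \<open>c > 0\<close> into
  \<open>q\<^sup>-\<^sup>1\<int>[q\<^sup>-\<^sup>1]\<close> (\<open>act_tev_unitriangular\<close>).  In degree greater than \<open>\<mu>\<close>, \<open>N\<close> is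
  negative, and every summand vanishes: either \<open>G(N, c) = 0\<close>, or the index of \<open>w\<close> exceeds \<open>\<mu>\<close>
  (\<open>act_tev_eq_0\<close>).

  So the divided powers of degree at most \<open>\<mu>\<close> give a basis of the module.  The bar involution exists and
  is unique, since it conjugates the coordinates with respect to this basis by \<open>q \<mapsto> q\<^sup>-\<^sup>1\<close>, and the basis has the
  defining properties of the canonical one.  Uniqueness of the canonical basis is the usual argument: by
  unitriangularity, the top coefficient of a bar invariant vector with coefficients in
  \<open>q\<^sup>-\<^sup>1\<int>[q\<^sup>-\<^sup>1]\<close> is itself bar invariant, hence zero (\<open>bar_fixed_lattice_zero\<close>).

  For the second part, the recursion shows that the divided powers span the coideal subalgebra
  (\<open>Ui_subset_span_tev\<close>), and a combination of finitely many of them is detected by a single module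
  of large enough highest weight (\<open>tev_combination_faithful\<close>), so that \<open>tev a\<close> is the only element that
  specializes to the canonical basis vectors of index \<open>a\<close>.
\<close>

section \<open>The field and its bar automorphism\<close>

lemma poly_map_poly_add:
  fixes f :: "'a::comm_ring_1 \<Rightarrow> 'b::comm_ring_1"
  assumes "f 0 = 0" "\<And>a b. f (a + b) = f a + f b"
  shows "poly (map_poly f (p + r)) x = poly (map_poly f p) x + poly (map_poly f r) x"
  by (induction p r rule: poly_induct2) (simp_all add: assms map_poly_pCons algebra_simps)

lemma poly_map_poly_mult:
  fixes f :: "'a::comm_ring_1 \<Rightarrow> 'b::comm_ring_1"
  assumes f: "f 0 = 0" "\<And>a b. f (a + b) = f a + f b" "\<And>a b. f (a * b) = f a * f b"
  shows "poly (map_poly f (p * r)) x = poly (map_poly f p) x * poly (map_poly f r) x"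
proof (induction p)
  case (pCons a p)
  have "poly (map_poly f (smult a r)) x = f a * poly (map_poly f r) x"
    using f by (induction r) (simp_all add: map_poly_pCons algebra_simps)
  with pCons.IH show ?case
    by (simp add: poly_map_poly_add f map_poly_pCons algebra_simps)
qed simp

lemma to_fract_hom:
  "to_fract 0 = 0" "to_fract 1 = 1" "to_fract (a + b) = to_fract a + to_fract b"
  "to_fract (a * b) = to_fract a * to_fract b"
  by simp_all

lemma qq_to_fract: "qq = to_fract [:0, 1:]"
  by (simp add: qq_def to_fract_def)

lemma Qq_of_rat_to_fract: "Qq_of_rat c = to_fract [:c:]"
  by (simp add: Qq_of_rat_def to_fract_def)

lemma Qq_of_rat_hom:
  "Qq_of_rat 0 = 0" "Qq_of_rat 1 = 1" "Qq_of_rat (a + b) = Qq_of_rat a + Qq_of_rat b"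
  "Qq_of_rat (a * b) = Qq_of_rat a * Qq_of_rat b"
  unfolding Qq_of_rat_to_fract to_fract_hom[symmetric]
  by (simp_all add: one_pCons[symmetric] del: to_fract_hom)

lemma Qq_of_rat_eq_0_iff: "Qq_of_rat c = 0 \<longleftrightarrow> c = 0"
  by (simp add: Qq_of_rat_to_fract)

lemma to_fract_pCons: "to_fract (pCons a p) = Qq_of_rat a + qq * to_fract p"
proof -
  have "pCons a p = [:a:] + [:0, 1:] * p" by simp
  then show ?thesis by (simp only: to_fract_hom qq_to_fract Qq_of_rat_to_fract)
qed

lemma to_fract_eq_poly_qq: "to_fract p = poly (map_poly Qq_of_rat p) qq"
  by (induction p) (simp_all add: map_poly_pCons Qq_of_rat_hom to_fract_pCons)

definition at_inverse_qq :: "rat poly \<Rightarrow> Qq" where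
  "at_inverse_qq p = poly (map_poly Qq_of_rat p) (inverse qq)"

lemma at_inverse_qq_hom:
  "at_inverse_qq 0 = 0" "at_inverse_qq 1 = 1"
  "at_inverse_qq (p + r) = at_inverse_qq p + at_inverse_qq r"
  "at_inverse_qq (p * r) = at_inverse_qq p * at_inverse_qq r"
  by (simp_all add: at_inverse_qq_def poly_map_poly_add poly_map_poly_mult Qq_of_rat_hom)

lemma at_inverse_qq_pCons:
  "at_inverse_qq (pCons a p) = Qq_of_rat a + inverse qq * at_inverse_qq p"
  by (simp add: at_inverse_qq_def map_poly_pCons Qq_of_rat_hom)

text \<open>Clearing the denominator of \<open>p(q\<^sup>-\<^sup>1)\<close> reverses the coefficients of \<open>p\<close>.  In particular
  \<open>q\<^sup>-\<^sup>1\<close> is transcendental, so the substitution extends to fractions.\<close>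

lemma at_inverse_qq_reflect: "qq ^ degree p * at_inverse_qq p = to_fract (reflect_poly p)"
proof -
  let ?P = "map_poly Qq_of_rat p"
  have deg: "degree ?P = degree p"
    by (rule degree_map_poly) (simp add: Qq_of_rat_eq_0_iff)
  have "reflect_poly ?P = map_poly Qq_of_rat (reflect_poly p)"
    by (rule poly_eqI) (simp add: coeff_reflect_poly coeff_map_poly Qq_of_rat_hom deg)
  then show ?thesis
    using poly_reflect_poly_nz[OF qq_nonzero, of ?P]
    by (simp add: to_fract_eq_poly_qq at_inverse_qq_def deg)
qed

lemma at_inverse_qq_eq_0_iff: "at_inverse_qq p = 0 \<longleftrightarrow> p = 0"
  using at_inverse_qq_reflect[of p] qq_nonzero by (auto simp: at_inverse_qq_hom)

text \<open>Multiplying \<open>p(q) = p(q\<^sup>-\<^sup>1)\<close> by \<open>q\<close> to the power \<open>degree p\<close> doubles the degree on the left,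
  while the right hand side becomes the reversed polynomial, whose degree is at most \<open>degree p\<close>.\<close>

lemma bar_fixed_poly_constant:
  assumes "to_fract p = at_inverse_qq p"
  shows "degree p = 0"
proof (rule ccontr)
  assume "degree p \<noteq> 0"
  then have p: "p \<noteq> 0" by auto
  have "to_fract (monom 1 (degree p) * p) = to_fract (reflect_poly p)"
    using at_inverse_qq_reflect[of p] assms
    by (simp only: to_fract_hom qq_power to_fract_def[of "monom _ _"])
  then have "degree (monom 1 (degree p) * p) = degree (reflect_poly p)" by (simp only: to_fract_eq_iff)
  then have "degree p + degree p = degree (reflect_poly p)"
    using p by (simp add: degree_mult_eq degree_monom_eq)
  with degree_reflect_poly_le[of p] \<open>degree p \<noteq> 0\<close> show False by simp
qed

text \<open>The automorphism of \<open>\<rat>(q)\<close> over \<open>\<rat>\<close> that inverts \<open>q\<close>.  A representation as a fraction is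
  chosen arbitrarily; \<open>bar_Fract\<close> shows that the choice does not matter.\<close>

definition bar :: "Qq \<Rightarrow> Qq" where
  "bar x = (SOME y. \<exists>a b. b \<noteq> 0 \<and> x = Fract a b \<and> y = at_inverse_qq a / at_inverse_qq b)"

lemma bar_Fract: assumes "b \<noteq> 0" shows "bar (Fract a b) = at_inverse_qq a / at_inverse_qq b"
  unfolding bar_def
proof (rule some_equality)
  fix y assume "\<exists>c d. d \<noteq> 0 \<and> Fract a b = Fract c d \<and> y = at_inverse_qq c / at_inverse_qq d"
  then obtain c d where cd: "d \<noteq> 0" "Fract a b = Fract c d" "y = at_inverse_qq c / at_inverse_qq d"
    by blast
  then have "a * d = c * b" using assms by (simp add: eq_fract)
  then have "at_inverse_qq a * at_inverse_qq d = at_inverse_qq c * at_inverse_qq b"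
    by (simp flip: at_inverse_qq_hom)
  then show "y = at_inverse_qq a / at_inverse_qq b"
    using assms cd at_inverse_qq_eq_0_iff by (simp add: frac_eq_eq)
qed (use assms in blast)

lemma bar_to_fract: "bar (to_fract p) = at_inverse_qq p"
  by (simp add: to_fract_def bar_Fract at_inverse_qq_hom)

lemma bar_add: "bar (x + y) = bar x + bar y"
proof -
  obtain a b c d where "x = Fract a b" "b \<noteq> 0" "y = Fract c d" "d \<noteq> 0"
    by (metis Fract_cases)
  then show ?thesis
    by (simp add: bar_Fract at_inverse_qq_hom add_frac_eq at_inverse_qq_eq_0_iff)
qed

lemma bar_mult: "bar (x * y) = bar x * bar y"
proof -
  obtain a b c d where "x = Fract a b" "b \<noteq> 0" "y = Fract c d" "d \<noteq> 0"
    by (metis Fract_cases)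
  then show ?thesis
    by (simp add: bar_Fract at_inverse_qq_hom)
qed

lemma bar_0: "bar 0 = 0" and bar_1: "bar 1 = 1"
  using bar_to_fract[of 0] bar_to_fract[of 1] by (simp_all add: at_inverse_qq_hom)

lemma bar_eq_0_iff: "bar x = 0 \<longleftrightarrow> x = 0"
proof
  assume 0: "bar x = 0"
  show "x = 0"
  proof (rule ccontr)
    assume "x \<noteq> 0"
    then have "bar x * bar (inverse x) = 1" by (simp add: bar_1 flip: bar_mult)
    with 0 show False by simp
  qed
qed (simp add: bar_0)

lemma bar_Qq_of_rat: "bar (Qq_of_rat c) = Qq_of_rat c"
  by (simp add: Qq_of_rat_to_fract bar_to_fract at_inverse_qq_pCons at_inverse_qq_hom)

lemma bar_qq: "bar qq = inverse qq"
  unfolding qq_to_fract bar_to_fract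
  by (simp add: qq_to_fract at_inverse_qq_pCons at_inverse_qq_hom Qq_of_rat_hom)

lemma bar_inverse_qq: "bar (inverse qq) = qq"
proof -
  have "bar (inverse qq) * inverse qq = 1"
    using bar_mult[of "inverse qq" qq] qq_nonzero by (simp add: bar_qq bar_1)
  then show ?thesis using qq_nonzero by (simp add: field_simps)
qed

lemma bar_at_inverse_qq: "bar (at_inverse_qq p) = to_fract p"
  by (induction p)
    (simp_all add: at_inverse_qq_hom at_inverse_qq_pCons to_fract_pCons bar_0 bar_add bar_mult
      bar_Qq_of_rat bar_inverse_qq)

text \<open>The field is generated by \<open>\<rat>\<close> and \<open>q\<close>.  This serves to extend compatibility of a map with
  \<open>\<rat>\<close> and \<open>q\<close>, as it is required of a bar involution, to all scalars.\<close>

lemma Qq_generated_by_qq: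
  fixes S :: "Qq set"
  assumes rat: "\<And>c. Qq_of_rat c \<in> S" and q: "qq \<in> S"
    and add: "\<And>x y. x \<in> S \<Longrightarrow> y \<in> S \<Longrightarrow> x + y \<in> S"
    and mult: "\<And>x y. x \<in> S \<Longrightarrow> y \<in> S \<Longrightarrow> x * y \<in> S"
    and div: "\<And>x y. x \<in> S \<Longrightarrow> y \<in> S \<Longrightarrow> y \<noteq> 0 \<Longrightarrow> x / y \<in> S"
  shows "x \<in> S"
proof -
  have poly: "to_fract p \<in> S" for p
    using add mult rat q rat[of 0] by (induction p) (simp_all add: to_fract_pCons Qq_of_rat_hom)
  obtain a b where "x = Fract a b" "b \<noteq> 0" by (metis Fract_cases)
  moreover from this have "x = to_fract a / to_fract b" by (simp add: to_fract_def)
  ultimately show ?thesis using div[OF poly[of a] poly[of b]] by simp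
qed

section \<open>The lattice of polynomials in the inverse of \<open>q\<close>\<close>

definition Zqinv :: "Qq set" where
  "Zqinv = {poly (map_poly of_int p) (inverse qq) | p :: int poly. True}"

lemma qinv_Zqinv_eq: "qinv_Zqinv = (\<lambda>x. inverse qq * x) ` Zqinv"
  by (auto simp: qinv_Zqinv_def Zqinv_def)

lemma Zqinv_of_int: "of_int i \<in> Zqinv"
proof -
  have "of_int i = poly (map_poly of_int [:i:]) (inverse qq)" by (simp add: map_poly_pCons)
  then show ?thesis unfolding Zqinv_def by blast
qed

lemma Zqinv_inverse_qq: "inverse qq \<in> Zqinv"
proof -
  have "inverse qq = poly (map_poly of_int [:0, 1:]) (inverse qq)" by (simp add: map_poly_pCons)
  then show ?thesis unfolding Zqinv_def by blast
qed

lemma Zqinv_add: assumes "x \<in> Zqinv" "y \<in> Zqinv" shows "x + y \<in> Zqinv"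
proof -
  obtain p r :: "int poly"
    where "x = poly (map_poly of_int p) (inverse qq)" "y = poly (map_poly of_int r) (inverse qq)"
    using assms unfolding Zqinv_def by blast
  then have "x + y = poly (map_poly of_int (p + r)) (inverse qq)" by (simp add: poly_map_poly_add)
  then show ?thesis unfolding Zqinv_def by blast
qed

lemma Zqinv_mult: assumes "x \<in> Zqinv" "y \<in> Zqinv" shows "x * y \<in> Zqinv"
proof -
  obtain p r :: "int poly"
    where "x = poly (map_poly of_int p) (inverse qq)" "y = poly (map_poly of_int r) (inverse qq)"
    using assms unfolding Zqinv_def by blast
  then have "x * y = poly (map_poly of_int (p * r)) (inverse qq)" by (simp add: poly_map_poly_mult)
  then show ?thesis unfolding Zqinv_def by blast
qed

lemma Zqinv_power: "x \<in> Zqinv \<Longrightarrow> x ^ n \<in> Zqinv"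
  using Zqinv_of_int[of 1] by (induction n) (simp_all add: Zqinv_mult)

lemma qinv_Zqinv_0: "0 \<in> qinv_Zqinv"
  using Zqinv_of_int[of 0] by (auto simp: qinv_Zqinv_eq)

lemma qinv_Zqinv_add: assumes "x \<in> qinv_Zqinv" "y \<in> qinv_Zqinv" shows "x + y \<in> qinv_Zqinv"
proof -
  obtain a b where ab: "x = inverse qq * a" "a \<in> Zqinv" "y = inverse qq * b" "b \<in> Zqinv"
    using assms by (auto simp: qinv_Zqinv_eq)
  then have "x + y = inverse qq * (a + b)" by (simp add: algebra_simps)
  with ab Zqinv_add show ?thesis unfolding qinv_Zqinv_eq by blast
qed

lemma qinv_Zqinv_diff: assumes "x \<in> qinv_Zqinv" "y \<in> qinv_Zqinv" shows "x - y \<in> qinv_Zqinv"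
proof -
  obtain a b where ab: "x = inverse qq * a" "a \<in> Zqinv" "y = inverse qq * b" "b \<in> Zqinv"
    using assms by (auto simp: qinv_Zqinv_eq)
  then have "a + of_int (- 1) * b \<in> Zqinv" by (intro Zqinv_add Zqinv_mult Zqinv_of_int)
  moreover have "x - y = inverse qq * (a + of_int (- 1) * b)" using ab by (simp add: algebra_simps)
  ultimately show ?thesis by (auto simp: qinv_Zqinv_eq)
qed

text \<open>For \<open>x = r(q\<^sup>-\<^sup>1)\<close> with \<open>r\<close> divisible by the variable, invariance means \<open>r(q) = r(q\<^sup>-\<^sup>1)\<close>.  Hence
  \<open>r\<close> is constant, and its constant coefficient is zero.\<close>

lemma bar_fixed_qinv_Zqinv:
  assumes "x \<in> qinv_Zqinv" "bar x = x"
  shows "x = 0"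
proof -
  obtain p :: "int poly" where p: "x = inverse qq * poly (map_poly of_int p) (inverse qq)"
    using assms(1) by (auto simp: qinv_Zqinv_def)
  \<comment> \<open>The factor \<open>q\<^sup>-\<^sup>1\<close> of \<open>x\<close> becomes the zero constant coefficient of \<open>r\<close>.\<close>
  define r :: "rat poly" where "r = pCons 0 (map_poly of_int p)"
  have of_int: "Qq_of_rat (of_int i) = of_int i" for i
  proof -
    have "Qq_of_rat (of_nat n) = of_nat n" for n
      by (induction n) (simp_all add: Qq_of_rat_hom)
    moreover have "Qq_of_rat (- c) = - Qq_of_rat c" for c
      using Qq_of_rat_hom(3)[of c "- c"] by (simp add: Qq_of_rat_hom add_eq_0_iff)
    ultimately show ?thesis by (cases i rule: int_cases2) simp_all
  qed
  have "map_poly Qq_of_rat (map_poly of_int p) = map_poly of_int p"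
    by (simp add: map_poly_map_poly Qq_of_rat_hom o_def of_int)
  then have x: "x = at_inverse_qq r"
    by (simp add: p r_def at_inverse_qq_def map_poly_pCons Qq_of_rat_hom)
  then have "to_fract r = at_inverse_qq r"
    using assms(2) by (simp add: bar_at_inverse_qq)
  then have "degree r = 0" by (rule bar_fixed_poly_constant)
  then have "r = 0" by (simp add: r_def degree_pCons_eq_if split: if_splits)
  then show ?thesis by (simp add: x at_inverse_qq_hom)
qed

section \<open>Gaussian binomial coefficients\<close>

text \<open>With \<open>z = q\<^sup>-\<^sup>4\<close> this is the Gaussian binomial coefficient \<open>(N + c choose c)\<close> in the variable \<open>z\<close>,
  as a rational function that also makes sense for negative \<open>N\<close>.\<close>

primrec gbin :: "int \<Rightarrow> nat \<Rightarrow> Qq" where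
  "gbin N 0 = 1"
| "gbin N (Suc c) =
    gbin N c * (1 - qq powi (- 4 * (N + 1 + int c))) / (1 - qq powi (- 4 * (1 + int c)))"

lemma one_minus_qq_powi_nonzero: "n > 0 \<Longrightarrow> 1 - qq powi (- 4 * n) \<noteq> 0"
proof
  assume n: "n > 0" "1 - qq powi (- 4 * n) = 0"
  then have "qq powi (- 4 * n) = 1" by simp
  then have "qq powi (4 * n) = 1" by (simp add: power_int_minus)
  moreover have "4 * n = int (nat (4 * n))" using n by simp
  ultimately have "qq ^ nat (4 * n) = 1" by (metis power_int_of_nat)
  with qq_power_neq_1[of "nat (4 * n)"] n show False by simp
qed

text \<open>Passing from \<open>N\<close> to \<open>N - 1\<close> moves the window of \<open>c + 1\<close> consecutive factors in the numerator by
  one, so all factors but one are common.\<close>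

lemma gbin_lower:
  "gbin (N - 1) (Suc c) = gbin N c * (1 - qq powi (- 4 * N)) / (1 - qq powi (- 4 * (1 + int c)))"
proof (induction c)
  case (Suc c)
  have "N - 1 + 1 + int (Suc c) = N + 1 + int c" by simp
  then have "gbin (N - 1) (Suc (Suc c)) = gbin (N - 1) (Suc c) *
      (1 - qq powi (- 4 * (N + 1 + int c))) / (1 - qq powi (- 4 * (1 + int (Suc c))))"
    by (simp only: gbin.simps(2)[of _ "Suc c"])
  then show ?case
    unfolding Suc.IH gbin.simps(2)[of N c]
    by (simp only: times_divide_eq_left times_divide_eq_right divide_divide_eq_left mult_ac)
qed simp

lemma gbin_Pascal: "gbin N (Suc c) = gbin (N - 1) (Suc c) + qq powi (- 4 * N) * gbin N c"
proof -
  have split: "qq powi (- 4 * (N + 1 + int c)) = qq powi (- 4 * N) * qq powi (- 4 * (1 + int c))"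
    using qq_nonzero by (simp flip: power_int_add add: algebra_simps)
  have Pascal: "x * (1 - a * b) / (1 - b) = x * (1 - a) / (1 - b) + a * x"
    if "1 - b \<noteq> 0" for x a b :: Qq
    using that by (simp add: divide_simps) (simp add: algebra_simps)
  show ?thesis
    unfolding gbin_lower
    unfolding gbin.simps(2) split by (intro Pascal one_minus_qq_powi_nonzero) simp
qed

lemma gbin_minus_1: "gbin (- 1) (Suc c) = 0"
  using gbin_lower[of 0 c] by simp

text \<open>Integrality of Gaussian binomial coefficients, by the recursion of Pascal.\<close>

lemma gbin_Zqinv: "gbin (int n) c \<in> Zqinv"
proof (induction c arbitrary: n)
  case 0
  show ?case using Zqinv_of_int[of 1] by simp
next
  case (Suc c)
  have powi: "qq powi (- 4 * int k) = inverse qq ^ (4 * k)" for k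
    using power_int_of_nat[of "inverse qq" "4 * k"] by (simp add: power_int_minus power_int_inverse)
  then have z: "qq powi (- 4 * int k) * gbin (int k) c \<in> Zqinv" for k
    using Suc.IH Zqinv_inverse_qq by (simp add: Zqinv_mult Zqinv_power)
  show ?case
  proof (induction n)
    case 0
    show ?case
      using z[of 0] gbin_Pascal[of 0 c] gbin_minus_1[of c] by (simp del: gbin.simps(2))
  next
    case (Suc n)
    then show ?case
      using z[of "Suc n"] gbin_Pascal[of "int (Suc n)" c] by (simp add: Zqinv_add del: gbin.simps(2))
  qed
qed

text \<open>On the highest weight vector of highest weight \<open>2 * l\<close>, these are the coefficients of
  \<open>F\<^sup>(\<^sup>n\<^sup>-\<^sup>2\<^sup>c\<^sup>)\<close> in the divided power of degree \<open>n = 2 * m\<close> or \<open>n = 2 * m + 1\<close>, respectively.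
  Written in this form they visibly lie in \<open>q\<^sup>-\<^sup>1\<int>[q\<^sup>-\<^sup>1]\<close> for \<open>c > 0\<close> and \<open>n \<le> 2 * l\<close>, because then
  the parameter \<open>N\<close> of the Gaussian binomial coefficient is a natural number.\<close>

definition ev_coeff :: "int \<Rightarrow> int \<Rightarrow> nat \<Rightarrow> Qq" where
  "ev_coeff l m c = qq powi (- (int c * (2 * int c - 1))) * gbin (l - m) c"

definition odd_coeff :: "int \<Rightarrow> int \<Rightarrow> nat \<Rightarrow> Qq" where
  "odd_coeff l m c = qq powi (- (int c * (2 * int c + 1))) * gbin (l - m - 1) c"

text \<open>The factor by which \<open>Echeck\<close> maps \<open>F\<^sup>(\<^sup>k\<^sup>)\<close> to \<open>F\<^sup>(\<^sup>k\<^sup>-\<^sup>1\<^sup>)\<close> on the highest weight vector of highest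
  weight \<open>2 * l\<close>.\<close>

definition Echeck_coeff :: "int \<Rightarrow> int \<Rightarrow> Qq" where
  "Echeck_coeff l k = qq powi (2 * k - 1 - 2 * l) * qint (2 * l - k + 1)"

lemma coeff_0: "ev_coeff l m 0 = 1" "odd_coeff l m 0 = 1"
  by (simp_all add: ev_coeff_def odd_coeff_def)

text \<open>Used as rewrite rules, these turn every polynomial identity in powers of \<open>q\<close> into a comparison of
  sums of monomials with symbolic exponents.\<close>

lemma qq_powi_mult:
  "qq powi a * qq powi b = qq powi (a + b)" "qq powi a * (qq powi b * x) = qq powi (a + b) * x"
  using qq_nonzero by (simp_all add: power_int_add)

text \<open>This and the next identity express the recursion of the divided powers in terms of coefficients.
  All Gaussian binomial coefficients involved are simple multiples of a common one, \<open>H\<close>; without it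
  and without denominators, the identities are between Laurent polynomials, and expanding
  both sides proves them.\<close>

lemma odd_step:
  "qint (2 * m + 2 - 2 * int (Suc c)) * odd_coeff l m (Suc c) +
    Echeck_coeff l (2 * m + 3 - 2 * int (Suc c)) * odd_coeff l m c
   = qint (2 * m + 2) * ev_coeff l (m + 1) (Suc c)"
proof -
  have combine: "x1 / e * (q1 * (H * N / D)) + d * (y / e) * (q0 * H) = z / e * (q2 * (H * N / D))"
    if "x1 * q1 * N + d * y * q0 * D = z * q2 * N" "D \<noteq> 0" "e \<noteq> 0"
    for x1 e q1 H N D d y q0 z q2 :: Qq
  proof -
    have "x1 / e * (q1 * (H * N / D)) + d * (y / e) * (q0 * H) = H * (x1 * q1 * N + d * y * q0 * D) / (e * D)"
      using that(2,3) by (simp add: divide_simps algebra_simps)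
    also have "\<dots> = z / e * (q2 * (H * N / D))" unfolding that(1) by simp
    finally show ?thesis .
  qed
  have *: "l - (m + 1) = l - m - 1" by simp
  show ?thesis
    unfolding ev_coeff_def odd_coeff_def Echeck_coeff_def qint_def gbin.simps(2) *
    by (rule combine[OF _ one_minus_qq_powi_nonzero qq_minus_inverse])
      (simp_all add: qq_powi_mult algebra_simps)
qed

lemma ev_step:
  "qint (2 * m + 1 - 2 * int (Suc c)) * ev_coeff l m (Suc c) +
    Echeck_coeff l (2 * m + 2 - 2 * int (Suc c)) * ev_coeff l m c
   = qint (2 * m + 1) * odd_coeff l m (Suc c) + qint (2 * m) * odd_coeff l (m - 1) c"
proof -
  have combine: "x1 / e * (q1 * (H * N1 / D)) + d * (y / e) * (q0 * H) =
      z / e * (q2 * (H * N2 / D)) + w / e * (q3 * H)"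
    if "x1 * q1 * N1 + d * y * q0 * D = z * q2 * N2 + w * q3 * D" "D \<noteq> 0" "e \<noteq> 0"
    for x1 e q1 H N1 N2 D d y q0 z q2 w q3 :: Qq
  proof -
    have "x1 / e * (q1 * (H * N1 / D)) + d * (y / e) * (q0 * H) =
        H * (x1 * q1 * N1 + d * y * q0 * D) / (e * D)"
      using that(2,3) by (simp add: divide_simps algebra_simps)
    also have "\<dots> = z / e * (q2 * (H * N2 / D)) + w / e * (q3 * H)"
      unfolding that(1) using that(2,3) by (simp add: divide_simps algebra_simps)
    finally show ?thesis .
  qed
  have *: "l - (m - 1) - 1 = l - m" by simp
  show ?thesis
    unfolding ev_coeff_def odd_coeff_def Echeck_coeff_def qint_def gbin_lower * 
    unfolding gbin.simps(2)
    by (rule combine[OF _ one_minus_qq_powi_nonzero qq_minus_inverse])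
      (simp_all add: qq_powi_mult algebra_simps)
qed

text \<open>The exponents in the numerator run through consecutive multiples of four from a nonnegative to a
  nonpositive one, so one of the factors is \<open>1 - q\<^sup>0\<close>.\<close>

lemma gbin_eq_0: "N < 0 \<Longrightarrow> N + int c \<ge> 0 \<Longrightarrow> gbin N c = 0"
proof (induction c)
  case (Suc c)
  then show ?case by (cases "N + 1 + int c = 0") simp_all
qed simp

lemma qq_powi_neg_gbin_qinv_Zqinv:
  assumes "k > 0"
  shows "qq powi (- k) * gbin (int n) c \<in> qinv_Zqinv"
proof -
  define j where "j = nat (k - 1)"
  have k: "- k = - int (Suc j)" using assms by (simp add: j_def)
  have "qq powi (- k) = inverse qq * inverse qq ^ j"
    unfolding k by (simp add: power_int_minus power_int_of_nat power_inverse del: of_nat_Suc)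
  then have "qq powi (- k) * gbin (int n) c = inverse qq * (inverse qq ^ j * gbin (int n) c)"
    by (simp add: mult.assoc)
  then show ?thesis
    unfolding qinv_Zqinv_eq using gbin_Zqinv Zqinv_inverse_qq Zqinv_mult Zqinv_power by blast
qed

lemma ev_coeff_qinv_Zqinv: assumes "m \<le> l" shows "ev_coeff (int l) (int m) (Suc c) \<in> qinv_Zqinv"
proof -
  have "int (Suc c) * (2 * int (Suc c) - 1) > 0" by simp
  moreover have "int l - int m = int (l - m)" using assms by simp
  ultimately show ?thesis unfolding ev_coeff_def by (metis qq_powi_neg_gbin_qinv_Zqinv)
qed

lemma odd_coeff_qinv_Zqinv: assumes "m < l" shows "odd_coeff (int l) (int m) (Suc c) \<in> qinv_Zqinv"
proof -
  have "int (Suc c) * (2 * int (Suc c) + 1) > 0" by simp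
  moreover have "int l - int m - 1 = int (l - m - 1)" using assms by simp
  ultimately show ?thesis unfolding odd_coeff_def by (metis qq_powi_neg_gbin_qinv_Zqinv)
qed

section \<open>The algebra and the recursion of the divided powers\<close>

lemma scalar_hom:
  "scalar 0 = 0" "scalar 1 = 1" "scalar (c + d) = scalar c + scalar d"
  "scalar (c * d) = scalar c * scalar d"
  by (transfer; rule ueq.refl ueq.const_add ueq.const_mul)+

lemma scalar_minus: "scalar (- c) = - scalar c"
  using scalar_hom(3)[of c "- c"] by (simp add: scalar_hom add_eq_0_iff)

lemma scalar_commute: "u * scalar c = scalar c * u"
  by transfer (rule ueq.sym[OF ueq.const_central])

lemma scalar_left_commute: "u * (scalar c * x) = scalar c * (u * x)"
  by (metis mult.assoc scalar_commute)

lemma gKinv_gK: "gKinv * gK = 1"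
  by transfer (rule ueq.Kinv_K)

lemma gE_gF: "gE * gF = gF * gE + scalar (1 / (qq - inverse qq)) * (gK - gKinv)"
proof -
  have "gE * gF - gF * gE = scalar (1 / (qq - inverse qq)) * (gK - gKinv)"
    by transfer (rule ueq.E_F)
  then show ?thesis by (simp add: algebra_simps)
qed

lemma gK_gF: "gK * gF = scalar (inverse (qq\<^sup>2)) * (gF * gK)"
  by transfer (rule ueq.K_F)

lemma Uq_induct [case_names E F K Kinv scalar add mult]:
  assumes "P gE" "P gF" "P gK" "P gKinv" "\<And>c. P (scalar c)"
    "\<And>x y. P x \<Longrightarrow> P y \<Longrightarrow> P (x + y)" "\<And>x y. P x \<Longrightarrow> P y \<Longrightarrow> P (x * y)"
  shows "P u"
proof -
  have "P (abs_Uq x)" for x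
    by (induction x)
      (use assms in \<open>simp_all add: gE.abs_eq gF.abs_eq gK.abs_eq gKinv.abs_eq scalar.abs_eq
        flip: plus_Uq.abs_eq times_Uq.abs_eq\<close>)
  then show ?thesis using Uq_abs_cases by metis
qed

lemma qfact_Suc: "qfact (Suc n) = qfact n * qint (int (Suc n))"
  by (simp add: qfact_def)

lemma qint_minus: "qint (- n) = - qint n"
  by (simp add: qint_def divide_simps)

lemma tt_prod_commute: "tt * tt_prod l u = tt_prod l u * tt"
proof -
  have "tt * (\<Prod>i\<leftarrow>xs. tt - scalar (qint (2 * i))) = (\<Prod>i\<leftarrow>xs. tt - scalar (qint (2 * i))) * tt" for xs
  proof (induction xs)
    case (Cons i xs)
    let ?f = "tt - scalar (qint (2 * i))" and ?p = "\<Prod>i\<leftarrow>xs. tt - scalar (qint (2 * i))"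
    have "tt * (?f * ?p) = ?f * (tt * ?p)"
      by (simp add: algebra_simps) (simp add: scalar_commute flip: mult.assoc)
    then show ?case by (simp add: Cons.IH mult.assoc)
  qed simp
  then show ?thesis by (simp add: tt_prod_def)
qed

text \<open>The two outer factors of the longer product are \<open>tt + [2 a + 2]\<close> and \<open>tt - [2 a + 2]\<close>.\<close>

lemma tt_prod_Suc:
  "tt_prod (- int (Suc a)) (int (Suc a)) =
    tt_prod (- int a) (int a) * (tt * tt - scalar ((qint (2 * int a + 2))\<^sup>2))"
proof -
  let ?P = "tt_prod (- int a) (int a)" and ?s = "scalar (qint (2 * int a + 2))"
  have "[- int (Suc a)..int (Suc a)] = - int (Suc a) # [- int a..int a] @ [int (Suc a)]"
    using upto_rec1[of "- int (Suc a)" "int (Suc a)"] upto_rec2[of "- int a" "int (Suc a)"] by simp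
  moreover have "qint (2 * (- int (Suc a))) = - qint (2 * int a + 2)"
    using qint_minus[of "2 * int a + 2"] by (simp add: algebra_simps)
  ultimately have "tt_prod (- int (Suc a)) (int (Suc a)) = (tt + ?s) * (?P * (tt - ?s))"
    by (simp add: tt_prod_def scalar_minus algebra_simps)
  also have "\<dots> = ?P * ((tt + ?s) * (tt - ?s))"
  proof -
    have "(tt + ?s) * ?P = ?P * (tt + ?s)"
      by (simp add: ring_distribs tt_prod_commute scalar_commute[of ?P])
    then show ?thesis by (simp only: mult.assoc[symmetric])
  qed
  also have "(tt + ?s) * (tt - ?s) = tt * tt - ?s * ?s"
    by (simp add: algebra_simps scalar_commute[of tt])
  finally show ?thesis by (simp add: power2_eq_square scalar_hom)
qed

lemma tev_0: "tev 0 = 1"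
  by (simp add: tev_def)

lemma tev_odd: "tev (2 * a + 1) = scalar (1 / qfact (2 * a + 1)) * tt_prod (- int a) (int a)"
  by (simp add: tev_def)

lemma tev_even:
  "tev (2 * a + 2) = scalar (1 / qfact (2 * a + 2)) * tt * tt_prod (- int a) (int a)"
  by (simp add: tev_def)

lemma tev_1: "tev 1 = tt"
  using tev_odd[of 0] qq_minus_inverse
  by (simp add: tt_prod_def qfact_def scalar_hom qint_def)

lemma tt_tev_odd: "tt * tev (2 * a + 1) = scalar (qint (2 * int a + 2)) * tev (2 * a + 2)"
proof -
  have eq: "scalar (1 / qfact (2 * a + 1)) = scalar (qint (2 * int a + 2)) * scalar (1 / qfact (2 * a + 2))"
    using qfact_Suc[of "2 * a + 1"] qint_nonzero[of "2 * int a + 2"]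
    by (simp add: algebra_simps flip: scalar_hom)
  show ?thesis
    unfolding tev_odd tev_even scalar_left_commute[of tt] by (simp only: eq mult.assoc)
qed

text \<open>Consecutive odd divided powers differ by the factor \<open>tt\<^sup>2 - [2 a + 2]\<^sup>2\<close>.  Its first summand gives the
  left hand side, its second one the divided power of lower degree on the right.\<close>

lemma tt_tev_even:
  "tt * tev (2 * a + 2) =
    scalar (qint (2 * int a + 3)) * tev (2 * a + 3) + scalar (qint (2 * int a + 2)) * tev (2 * a + 1)"
proof -
  define P s r where "P = tt_prod (- int a) (int a)" and "s = qint (2 * int a + 2)"
    and "r = 1 / qfact (2 * a + 2)"
  have s: "s \<noteq> 0" using qint_nonzero[of "2 * int a + 2"] by (simp add: s_def)
  have r1: "1 / qfact (2 * a + 1) = r * s"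
    using qfact_Suc[of "2 * a + 1"] s by (simp add: r_def s_def algebra_simps)
  have r3: "qint (2 * int a + 3) * (1 / qfact (2 * a + 3)) = r"
    using qfact_Suc[of "2 * a + 2"] qint_nonzero[of "2 * int a + 3"]
    by (simp add: r_def algebra_simps numeral_3_eq_3)
  have odd: "tev (2 * a + 3) = scalar (1 / qfact (2 * a + 3)) * (P * (tt * tt - scalar (s\<^sup>2)))"
  proof -
    have "2 * a + 3 = 2 * Suc a + 1" by simp
    then show ?thesis by (simp only: tev_odd tt_prod_Suc P_def s_def)
  qed
  have "scalar (qint (2 * int a + 3)) * tev (2 * a + 3) = scalar r * (P * (tt * tt - scalar (s\<^sup>2)))"
    unfolding odd by (metis r3 mult.assoc scalar_hom(4))
  also have "\<dots> = scalar r * (P * tt * tt) - scalar (r * s * s) * P"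
    by (simp add: right_diff_distrib scalar_commute[of P] scalar_left_commute[of P] scalar_hom power2_eq_square mult.assoc)
  also have "P * tt * tt = tt * tt * P"
    using tt_prod_commute by (metis P_def mult.assoc)
  finally have "scalar (qint (2 * int a + 3)) * tev (2 * a + 3) =
    scalar r * (tt * tt * P) - scalar (r * s * s) * P" .
  moreover have "scalar (qint (2 * int a + 2)) * tev (2 * a + 1) = scalar (r * s * s) * P"
  proof -
    have "scalar s * (scalar (r * s) * P) = scalar (s * (r * s)) * P"
      by (simp only: scalar_hom mult.assoc)
    also have "s * (r * s) = r * s * s" by simp
    finally show ?thesis unfolding tev_odd r1 by (simp only: P_def s_def)
  qed
  moreover have "tt * tev (2 * a + 2) = scalar r * (tt * tt * P)"
    unfolding tev_even by (simp add: P_def r_def scalar_left_commute[of tt] mult.assoc)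
  ultimately show ?thesis by simp
qed

section \<open>Triangular families of vectors\<close>

context vector_space
begin

lemma in_span_lessThan:
  fixes N :: nat
  shows "x \<in> span (f ` {..<N}) \<longleftrightarrow> (\<exists>c. x = (\<Sum>n<N. c n *s f n))"
proof (induction N arbitrary: x)
  case (Suc N)
  have "x \<in> span (f ` {..<Suc N}) \<longleftrightarrow> (\<exists>k c. x - k *s f N = (\<Sum>n<N. c n *s f n))"
    by (simp add: lessThan_Suc span_breakdown_eq Suc.IH)
  also have "\<dots> \<longleftrightarrow> (\<exists>c. x = (\<Sum>n<Suc N. c n *s f n))"
  proof
    assume "\<exists>k c. x - k *s f N = (\<Sum>n<N. c n *s f n)"
    then obtain k c where "x - k *s f N = (\<Sum>n<N. c n *s f n)" by blast
    then have "x = (\<Sum>n<Suc N. (c(N := k)) n *s f n)" by (simp add: diff_eq_eq)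
    then show "\<exists>c. x = (\<Sum>n<Suc N. c n *s f n)" by blast
  next
    assume "\<exists>c. x = (\<Sum>n<Suc N. c n *s f n)"
    then obtain c where "x = (\<Sum>n<Suc N. c n *s f n)" by blast
    then have "x - c N *s f N = (\<Sum>n<N. c n *s f n)" by simp
    then show "\<exists>k c. x - k *s f N = (\<Sum>n<N. c n *s f n)" by blast
  qed
  finally show ?case .
qed simp

lemma unitriangular_span:
  fixes N :: nat
  assumes "\<And>n. n < N \<Longrightarrow> p n - w n \<in> span (w ` {..<n})"
  shows "span (p ` {..<N}) = span (w ` {..<N})"
  using assms
proof (induction N)
  case (Suc N)
  let ?P = "span (p ` {..<Suc N})" and ?W = "span (w ` {..<Suc N})"
  have IH: "span (p ` {..<N}) = span (w ` {..<N})" using Suc by simp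
  have P: "span (w ` {..<N}) \<subseteq> ?P" unfolding IH[symmetric] by (rule span_mono) auto
  have W: "span (p ` {..<N}) \<subseteq> ?W" unfolding IH by (rule span_mono) auto
  have d: "p N - w N \<in> span (w ` {..<N})" using Suc.prems by simp
  have mem: "p N \<in> ?P" "w N \<in> ?W" by (auto intro: span_base)
  have "p N \<in> ?W"
    using span_add[OF mem(2), of "p N - w N"] d W IH by auto
  moreover have "w N \<in> ?P"
    using span_diff[OF mem(1), of "p N - w N"] d P by auto
  moreover have "p ` {..<N} \<subseteq> ?W" by (rule order.trans[OF span_superset W])
  moreover have "w ` {..<N} \<subseteq> ?P" by (rule order.trans[OF span_superset P])
  ultimately show ?case unfolding span_eq by (simp add: lessThan_Suc)
qed simp

text \<open>That no vector of a finite sequence lies in the span of its predecessors is the form in which linear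
  independence is used below, because it is inherited along unitriangular changes of the sequence.\<close>

lemma span_chain_independent:
  fixes N :: nat
  assumes "\<And>n. n < N \<Longrightarrow> f n \<notin> span (f ` {..<n})"
  shows "independent (f ` {..<N}) \<and> inj_on f {..<N}"
  using assms
proof (induction N)
  case (Suc N)
  have "f N \<notin> span (f ` {..<N})" using Suc.prems by simp
  moreover from this have "f N \<notin> f ` {..<N}" using span_base[of "f N" "f ` {..<N}"] by fast
  ultimately show ?case
    using Suc by (simp add: lessThan_Suc independent_insertI)
qed (simp add: independent_empty)

lemma span_chain_coeffs_zero:
  fixes N :: nat
  assumes "\<And>n. n < N \<Longrightarrow> f n \<notin> span (f ` {..<n})" "(\<Sum>n<N. c n *s f n) = 0" "n < N"
  shows "c n = 0"
  using assms
proof (induction N)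
  case (Suc N)
  have "c N = 0"
  proof (rule ccontr)
    assume "c N \<noteq> 0"
    have "c N *s f N = - (\<Sum>n<N. c n *s f n)"
      using Suc.prems(2) by (simp add: add_eq_0_iff)
    then have "c N *s f N \<in> span (f ` {..<N})"
      by (auto intro!: span_neg span_sum span_scale intro: span_base)
    then have "inverse (c N) *s (c N *s f N) \<in> span (f ` {..<N})" by (rule span_scale)
    then show False using Suc.prems(1)[of N] \<open>c N \<noteq> 0\<close> by simp
  qed
  with Suc show ?case by (cases "n = N") simp_all
qed simp

end

section \<open>Weight vectors of the simple module\<close>

context Uq_module
begin

lemma scale_in: "x \<in> V \<Longrightarrow> scale c x \<in> V"
  using subspace_carrier by (rule subspace_scale)

lemma act_zero_right: "act u 0 = 0"
  using act_add_right[of 0 0 u] subspace_carrier by (simp add: subspace_0)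

lemma act_scale: "x \<in> V \<Longrightarrow> act u (scale c x) = scale c (act u x)"
  by (metis act_closed act_mult act_scalar scalar_commute)

lemma act_sum: "(\<And>i. i \<in> I \<Longrightarrow> f i \<in> V) \<Longrightarrow> act u (\<Sum>i\<in>I. f i) = (\<Sum>i\<in>I. act u (f i))"
proof (induction I rule: infinite_finite_induct)
  case (insert i I)
  then show ?case
    using subspace_sum[OF subspace_carrier, of I f] by (simp add: act_add_right)
qed (simp_all add: act_zero_right)

lemma act_0: "x \<in> V \<Longrightarrow> act 0 x = 0"
  using act_scalar[of x 0] by (simp add: scalar_hom)

lemma act_1: "x \<in> V \<Longrightarrow> act 1 x = x"
  using act_scalar[of x 1] by (simp add: scalar_hom)

lemma act_diff_left: "x \<in> V \<Longrightarrow> act (u - w) x = act u x - act w x"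
  using act_add_left[of x "u - w" w] by simp

lemma act_sum_left: "x \<in> V \<Longrightarrow> act (\<Sum>i\<in>I. f i) x = (\<Sum>i\<in>I. act (f i) x)"
  by (induction I rule: infinite_finite_induct) (simp_all add: act_0 act_add_left)

lemma span_subset_carrier: "S \<subseteq> V \<Longrightarrow> span S \<subseteq> V"
  by (rule span_minimal[OF _ subspace_carrier])

text \<open>Closure of a span under one algebra element can be checked on the spanning vectors.\<close>

lemma act_span_closed:
  assumes "S \<subseteq> V" "\<And>x. x \<in> S \<Longrightarrow> act u x \<in> span S" "x \<in> span S"
  shows "act u x \<in> span S"
proof -
  have "subspace {x \<in> V. act u x \<in> span S}"
    using subspace_carrier
    by (auto simp: subspace_def act_zero_right act_add_right act_scale span_zero span_add span_scale)
  then have "span S \<subseteq> {x \<in> V. act u x \<in> span S}"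
    by (rule span_minimal[rotated]) (use assms in auto)
  then show ?thesis using assms(3) by auto
qed

lemma submodule_span:
  assumes "S \<subseteq> V"
    and "\<And>x. x \<in> S \<Longrightarrow> act gE x \<in> span S" "\<And>x. x \<in> S \<Longrightarrow> act gF x \<in> span S"
    and "\<And>x. x \<in> S \<Longrightarrow> act gK x \<in> span S" "\<And>x. x \<in> S \<Longrightarrow> act gKinv x \<in> span S"
  shows "submodule (span S)"
proof -
  have sub: "span S \<subseteq> V" using assms(1) by (rule span_subset_carrier)
  have "\<forall>x\<in>span S. act u x \<in> span S" for u
  proof (induction u rule: Uq_induct)
    case (scalar c) show ?case using sub by (metis act_scalar span_scale subsetD)
  next
    case (add x y) then show ?case using sub by (metis act_add_left span_add subsetD)
  next
    case (mult x y) then show ?case using sub by (metis act_mult subsetD)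
  qed (use assms act_span_closed in auto)
  then show ?thesis using sub by (simp add: submodule_def subspace_span)
qed

end

lemma Fdiv_0: "Fdiv 0 = 1"
  by (simp add: Fdiv_def qfact_def scalar_hom)

lemma gF_Fdiv: "gF * Fdiv n = scalar (qint (int n + 1)) * Fdiv (Suc n)"
proof -
  have eq: "qint (int n + 1) * (1 / qfact (Suc n)) = 1 / qfact n"
    using qint_nonzero[of "int n + 1"] by (simp add: qfact_Suc algebra_simps)
  have "scalar (qint (int n + 1)) * Fdiv (Suc n) = scalar (1 / qfact n) * (gF * gF ^ n)"
    by (simp only: Fdiv_def power_Suc mult.assoc[symmetric] scalar_hom(4)[symmetric] eq)
  also have "\<dots> = gF * Fdiv n" by (simp add: Fdiv_def scalar_left_commute[of gF])
  finally show ?thesis ..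
qed

context simple_hw_module
begin

text \<open>Negative indices are admitted, with value zero, so that the formulas for the action of \<open>E\<close> and \<open>F\<close>
  have no special cases.\<close>

definition wt :: "int \<Rightarrow> 'v" where
  "wt k = (if k < 0 then 0 else act (Fdiv (nat k)) vp)"

lemma wt_in: "wt k \<in> V"
  using subspace_carrier by (simp add: wt_def act_closed vp_in subspace_0)

lemma wt_neg: "k < 0 \<Longrightarrow> wt k = 0"
  by (simp add: wt_def)

lemma wt_nat: "wt (int n) = act (Fdiv n) vp"
  by (simp add: wt_def)

lemma wt_0: "wt 0 = vp"
  by (simp add: wt_def Fdiv_0 act_1 vp_in)

lemma act_gF_wt: "act gF (wt k) = scale (qint (k + 1)) (wt (k + 1))"
proof -
  consider "k < - 1" | "k = - 1" | n where "k = int n"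
    by (metis int_cases2 int_cases add.inverse_inverse not_less linorder_neqE neg_less_iff_less
        of_nat_less_0_iff zle_add1_eq_le add_neg_numeral_special(8) nonneg_int_cases)
  then show ?thesis
  proof cases
    case 3
    have "act gF (wt k) = act (gF * Fdiv n) vp"
      by (simp add: 3 wt_nat act_mult vp_in)
    also have "\<dots> = scale (qint (k + 1)) (act (Fdiv (Suc n)) vp)"
      by (simp add: gF_Fdiv 3 act_mult act_scalar act_closed vp_in)
    finally show ?thesis using wt_nat[of "Suc n"] by (simp add: 3 add.commute)
  qed (simp_all add: wt_neg act_zero_right qint_0)
qed

lemma wt_Suc: "wt (int (Suc n)) = scale (1 / qint (int n + 1)) (act gF (wt (int n)))"
  using act_gF_wt[of "int n"] qint_nonzero[of "int n + 1"] by (simp add: add.commute)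

lemma act_gK_wt: "act gK (wt k) = scale (qq powi (int \<mu> - 2 * k)) (wt k)"
proof (cases "k < 0")
  case False
  then obtain n where k: "k = int n" by (metis nonneg_int_cases not_less)
  have "act gK (wt (int n)) = scale (qq powi (int \<mu> - 2 * int n)) (wt (int n))"
  proof (induction n)
    case 0
    show ?case by (simp add: wt_0 act_K_vp power_int_of_nat)
  next
    case (Suc n)
    have "act gK (act gF (wt (int n))) = act (gK * gF) (wt (int n))"
      by (simp add: act_mult wt_in)
    also have "\<dots> = scale (inverse (qq\<^sup>2) * qq powi (int \<mu> - 2 * int n)) (act gF (wt (int n)))"
      by (simp add: gK_gF act_mult act_scalar act_scale act_closed wt_in Suc.IH)
    also have "inverse (qq\<^sup>2) * qq powi (int \<mu> - 2 * int n) = qq powi (int \<mu> - 2 * int (Suc n))"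
    proof -
      have "inverse (qq\<^sup>2) = qq powi (- 2)" by (simp add: power_int_minus)
      then show ?thesis by (simp add: qq_powi_mult algebra_simps del: power_int_minus_left)
    qed
    finally show ?case
      unfolding wt_Suc by (simp add: act_scale act_closed wt_in mult.commute del: of_nat_Suc)
  qed
  then show ?thesis by (simp add: k)
qed (simp add: wt_neg act_zero_right)

lemma act_gKinv_wt: "act gKinv (wt k) = scale (qq powi (2 * k - int \<mu>)) (wt k)"
proof -
  have "act gKinv (act gK (wt k)) = wt k"
    using act_mult[of "wt k" gKinv gK] by (simp add: gKinv_gK act_1 wt_in)
  then have "scale (qq powi (int \<mu> - 2 * k)) (act gKinv (wt k)) = wt k"
    by (simp add: act_gK_wt act_scale wt_in)
  then have "scale (qq powi (2 * k - int \<mu>)) (wt k) =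
      scale (qq powi (2 * k - int \<mu>) * qq powi (int \<mu> - 2 * k)) (act gKinv (wt k))"
    by (metis scale_scale)
  then show ?thesis by (simp add: qq_powi_mult)
qed

text \<open>Induction on \<open>k\<close> with the commutation relation of \<open>E\<close> and \<open>F\<close>; the step is the identity
  \<open>[\<mu> - n + 1] [n] + [\<mu> - 2 n] = [n + 1] [\<mu> - n]\<close> of \<open>q\<close>-integers.\<close>

lemma act_gE_wt: "act gE (wt k) = scale (qint (int \<mu> - k + 1)) (wt (k - 1))"
proof (cases "k < 0")
  case False
  then obtain n where k: "k = int n" by (metis nonneg_int_cases not_less)
  have "act gE (wt (int n)) = scale (qint (int \<mu> - int n + 1)) (wt (int n - 1))"
  proof (induction n)
    case 0
    show ?case by (simp add: wt_0 act_E_vp wt_neg)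
  next
    case (Suc n)
    let ?w = "wt (int n)"
    have K: "act (scalar (1 / (qq - inverse qq)) * (gK - gKinv)) ?w = scale (qint (int \<mu> - 2 * int n)) ?w"
      by (simp add: act_mult act_scalar act_diff_left scale_in wt_in act_gK_wt act_gKinv_wt qint_def
          scale_left_diff_distrib[symmetric])
    have F: "act gF (act gE ?w) = scale (qint (int \<mu> - int n + 1) * qint (int n)) ?w"
      by (simp add: Suc.IH act_scale wt_in act_gF_wt)
    have "act gE (act gF ?w) = act (gE * gF) ?w"
      by (simp add: act_mult wt_in)
    also have "\<dots> = scale (qint (int \<mu> - int n + 1) * qint (int n) + qint (int \<mu> - 2 * int n)) ?w"
      unfolding gE_gF act_add_left[OF wt_in] K by (simp add: act_mult wt_in F scale_left_distrib)
    also have "qint (int \<mu> - int n + 1) * qint (int n) + qint (int \<mu> - 2 * int n) =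
        qint (int n + 1) * qint (int \<mu> - int n)"
      using qint_comm[of "int \<mu>" "int n"] by (simp add: algebra_simps)
    finally have "act gE (wt (int (Suc n))) =
        scale (1 / qint (int n + 1) * (qint (int n + 1) * qint (int \<mu> - int n))) ?w"
      unfolding wt_Suc by (simp add: act_scale act_closed wt_in)
    then show ?case using qint_nonzero[of "int n + 1"] by simp
  qed
  then show ?thesis by (simp add: k)
qed (simp add: wt_neg act_zero_right)

text \<open>The weight vectors have different eigenvalues for \<open>K\<close>.  If \<open>x\<close> is a combination of the \<open>wt s\<close> with
  \<open>s \<in> S\<close>, the product of the factors \<open>K - q\<^bsup>\<mu> - 2 s\<^esup>\<close> over the indices that occur kills \<open>x\<close>, but it multiplies \<open>wt b\<close> by a nonzero scalar.\<close>

lemma wt_notin_span: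
  assumes "wt b \<noteq> 0" "b \<notin> S"
  shows "wt b \<notin> span (wt ` S)"
proof
  assume "wt b \<in> span (wt ` S)"
  moreover have "x \<in> V \<and> (\<exists>u. (\<forall>k. \<exists>c. act u (wt k) = scale c (wt k)) \<and> act u x = 0 \<and>
      (\<exists>c. c \<noteq> 0 \<and> act u (wt b) = scale c (wt b)))" if "x \<in> span (wt ` S)" for x
    using that
  proof (induction rule: span_induct_alt)
    case base
    show ?case
      using subspace_0[OF subspace_carrier]
      by (auto simp: act_1 wt_in act_zero_right intro!: exI[of _ "1 :: Uq"] intro: exI[of _ "1 :: Qq"])
  next
    case (step a x y)
    then obtain s where s: "s \<in> S" "x = wt s" by blast
    from step obtain u d where u: "\<And>k. \<exists>c. act u (wt k) = scale c (wt k)" "act u y = 0"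
      and d: "d \<noteq> 0" "act u (wt b) = scale d (wt b)" and y: "y \<in> V" by blast
    define u' where "u' = (gK - scalar (qq powi (int \<mu> - 2 * s))) * u"
    have u': "act u' (wt k) = scale (c * (qq powi (int \<mu> - 2 * k) - qq powi (int \<mu> - 2 * s))) (wt k)"
      if "act u (wt k) = scale c (wt k)" for k c
      unfolding u'_def
      by (simp add: act_mult wt_in that act_scale act_diff_left act_gK_wt act_scalar
          scale_left_diff_distrib right_diff_distrib scale_right_diff_distrib)
    have "act u' y = 0" by (simp add: u'_def act_mult y u act_zero_right)
    moreover have "act u' (wt s) = 0" using u(1)[of s] u' by force
    ultimately have "act u' (scale a x + y) = 0"
      using y subspace_carrier by (simp add: s act_add_right wt_in act_scale subspace_scale)
    moreover have "qq powi (int \<mu> - 2 * b) - qq powi (int \<mu> - 2 * s) \<noteq> 0"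
    proof
      assume "qq powi (int \<mu> - 2 * b) - qq powi (int \<mu> - 2 * s) = 0"
      moreover have "qq powi i \<noteq> qq powi j" if "i < j" for i j
      proof
        assume "qq powi i = qq powi j"
        then have "qq powi (j + - i) = 1"
          using qq_nonzero by (simp add: power_int_diff)
        then have "qq ^ nat (j - i) = 1" using that power_int_of_nat[of qq "nat (j - i)"] by simp
        with qq_power_neq_1[of "nat (j - i)"] that show False by simp
      qed
      ultimately have "int \<mu> - 2 * b = int \<mu> - 2 * s" by (metis linorder_neqE right_minus_eq)
      with s assms(2) show False by simp
    qed
    moreover have "scale a x + y \<in> V"
      using y subspace_carrier by (simp add: s scale_in wt_in subspace_add)
    ultimately show ?case using u' u(1) d by (metis mult_eq_0_iff)
  qed
  ultimately show False using assms(1) by (metis scale_eq_0_iff)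
qed

lemma submodule_span_wt:
  assumes "\<And>k. k \<in> S \<Longrightarrow> qint (int \<mu> - k + 1) = 0 \<or> wt (k - 1) \<in> span (wt ` S)"
    and "\<And>k. k \<in> S \<Longrightarrow> k + 1 \<in> S"
  shows "submodule (span (wt ` S))"
proof (rule submodule_span)
  show "wt ` S \<subseteq> V" using wt_in by blast
next
  fix x assume "x \<in> wt ` S"
  then obtain k where k: "k \<in> S" "x = wt k" by blast
  show "act gE x \<in> span (wt ` S)"
    using assms(1)[OF k(1)] by (auto simp: k act_gE_wt span_zero span_scale)
  have "wt k \<in> span (wt ` S)" "wt (k + 1) \<in> span (wt ` S)"
    using k assms(2) by (blast intro: span_base)+
  then show "act gF x \<in> span (wt ` S)" "act gK x \<in> span (wt ` S)" "act gKinv x \<in> span (wt ` S)"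
    by (simp_all add: k act_gF_wt act_gK_wt act_gKinv_wt span_scale)
qed

text \<open>The coefficient \<open>[\<mu> - k + 1]\<close> of \<open>E\<close> vanishes at \<open>k = \<mu> + 1\<close>, so the weight vectors with larger index
  than \<open>\<mu>\<close> span a submodule.  It does not contain \<open>vp\<close>; as the module is simple, it is zero.\<close>

lemma wt_eq_0: assumes "k > int \<mu>" shows "wt k = 0"
proof -
  let ?S = "{k. k > int \<mu>}"
  have "qint (int \<mu> - k + 1) = 0 \<or> wt (k - 1) \<in> span (wt ` ?S)" if "k \<in> ?S" for k
  proof (cases "k = int \<mu> + 1")
    case False
    then show ?thesis using that by (auto intro!: span_base)
  qed (simp add: qint_0)
  then have "submodule (span (wt ` ?S))" by (rule submodule_span_wt) auto
  then have "span (wt ` ?S) = {0} \<or> span (wt ` ?S) = V" by (rule simple)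
  moreover have "wt 0 \<notin> span (wt ` ?S)"
    by (rule wt_notin_span) (simp_all add: wt_0 vp_nonzero)
  ultimately have "span (wt ` ?S) = {0}" using vp_in by (auto simp: wt_0)
  then show ?thesis using assms span_base[of "wt k" "wt ` ?S"] by auto
qed

text \<open>Up to a nonzero scalar, \<open>E\<close> maps each of these vectors to the previous one.\<close>

lemma wt_nonzero: assumes "n \<le> \<mu>" shows "wt (int n) \<noteq> 0"
  using assms
proof (induction n)
  case 0
  show ?case by (simp add: wt_0 vp_nonzero)
next
  case (Suc n)
  show ?case
  proof
    assume "wt (int (Suc n)) = 0"
    then have "scale (qint (int \<mu> - int n)) (wt (int n)) = 0"
      using act_gE_wt[of "int (Suc n)"] by (simp add: act_zero_right)
    then show False using Suc qint_nonzero[of "int \<mu> - int n"] by simp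
  qed
qed

lemma span_wt: "span ((\<lambda>n. wt (int n)) ` {..<Suc \<mu>}) = V"
proof -
  have "submodule (span (range wt))"
    by (rule submodule_span_wt) (auto intro: span_base)
  moreover have "vp \<in> span (range wt)" by (metis rangeI span_base wt_0)
  ultimately have V: "span (range wt) = V" using simple vp_nonzero by blast
  have "wt k \<in> span ((\<lambda>n. wt (int n)) ` {..<Suc \<mu>})" for k
  proof (cases "0 \<le> k \<and> k \<le> int \<mu>")
    case True
    then have "k = int (nat k)" "nat k < Suc \<mu>" by auto
    then show ?thesis by (metis image_eqI lessThan_iff span_base)
  next
    case False
    then show ?thesis using wt_neg wt_eq_0 by (metis not_less span_zero)
  qed
  then have "V \<subseteq> span ((\<lambda>n. wt (int n)) ` {..<Suc \<mu>})"
    unfolding V[symmetric] by (intro span_minimal subspace_span) auto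
  moreover have "span ((\<lambda>n. wt (int n)) ` {..<Suc \<mu>}) \<subseteq> V"
    using wt_in by (intro span_subset_carrier) auto
  ultimately show ?thesis by blast
qed

end

section \<open>The divided powers on the highest weight vector\<close>

locale even_hw_module = simple_hw_module +
  fixes l :: nat
  assumes weight: "\<mu> = 2 * l"
begin

lemma act_tt_wt:
  "act tt (wt k) = scale (qint (k + 1)) (wt (k + 1)) + scale (Echeck_coeff (int l) k) (wt (k - 1))"
proof -
  have "act Echeck (wt k) =
      scale (inverse qq * (qq powi (2 * k - int \<mu>) * qint (int \<mu> - k + 1))) (wt (k - 1))"
    by (simp add: Echeck_def act_mult act_scalar act_scale scale_in wt_in act_closed
        act_gKinv_wt act_gE_wt mult.commute)
  also have "inverse qq * (qq powi (2 * k - int \<mu>) * qint (int \<mu> - k + 1)) = Echeck_coeff (int l) k"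
    using qq_powi_mult(1)[of "- 1" "2 * k - 2 * int l"]
    by (simp add: Echeck_coeff_def weight algebra_simps)
  finally show ?thesis by (simp add: tt_def act_add_left wt_in act_gF_wt add.commute)
qed

text \<open>In the sums below the upper limit \<open>N\<close> is arbitrary as long as all weight vectors of nonnegative
  index are covered.  Thus raising the index by one never produces a summand beyond the limit.\<close>

lemma sum_wt_shift:
  assumes "k < 2 * int (Suc N)"
  shows "(\<Sum>c\<le>N. scale (b c) (wt (k - 2 - 2 * int c))) =
    (\<Sum>c\<le>N. scale (case c of 0 \<Rightarrow> 0 | Suc j \<Rightarrow> b j) (wt (k - 2 * int c)))" (is "?l = ?r")
proof -
  have "?r + scale (b N) (wt (k - 2 * int (Suc N))) =
      (\<Sum>c\<le>Suc N. scale (case c of 0 \<Rightarrow> 0 | Suc j \<Rightarrow> b j) (wt (k - 2 * int c)))" by simp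
  also have "\<dots> = (\<Sum>c\<le>N. scale (b c) (wt (k - 2 * int (Suc c))))"
    by (subst sum.atMost_Suc_shift) simp
  also have "\<dots> = ?l" by (simp add: algebra_simps)
  finally show ?thesis using assms by (simp add: wt_neg)
qed

lemma act_tt_sum_wt:
  assumes "k + 1 < 2 * int (Suc N)"
  shows "act tt (\<Sum>c\<le>N. scale (x c) (wt (k - 2 * int c))) =
    (\<Sum>c\<le>N. scale (qint (k + 1 - 2 * int c) * x c +
        (case c of 0 \<Rightarrow> 0 | Suc j \<Rightarrow> Echeck_coeff (int l) (k - 2 * int j) * x j))
      (wt (k + 1 - 2 * int c)))"
proof -
  have "act tt (\<Sum>c\<le>N. scale (x c) (wt (k - 2 * int c))) =
      (\<Sum>c\<le>N. scale (qint (k + 1 - 2 * int c) * x c) (wt (k + 1 - 2 * int c))) +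
      (\<Sum>c\<le>N. scale (Echeck_coeff (int l) (k - 2 * int c) * x c) (wt (k + 1 - 2 - 2 * int c)))"
    by (simp add: act_sum scale_in wt_in act_scale act_tt_wt scale_right_distrib sum.distrib
        algebra_simps)
  then show ?thesis
    unfolding sum_wt_shift[OF assms] by (simp add: sum.distrib scale_left_distrib)
qed

text \<open>The closed formulas for even and odd degree are proved together, each from the previous one by the
  recursion \<open>tt_tev_odd\<close> or \<open>tt_tev_even\<close> of the divided powers and the matching identity of
  coefficients, \<open>odd_step\<close> or \<open>ev_step\<close>.\<close>

lemma act_tev_expansion:
  "(\<forall>N\<ge>m. act (tev (2 * m)) vp =
      (\<Sum>c\<le>N. scale (ev_coeff (int l) (int m) c) (wt (2 * int m - 2 * int c)))) \<and>
   (\<forall>N\<ge>m. act (tev (2 * m + 1)) vp =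
      (\<Sum>c\<le>N. scale (odd_coeff (int l) (int m) c) (wt (2 * int m + 1 - 2 * int c))))"
proof (induction m)
  case 0
  have vp: "(\<Sum>c\<le>N. scale (x c) (wt (- 2 * int c))) = scale (x 0) vp" for x N
    by (subst sum.atMost_shift) (simp add: wt_neg wt_0)
  have vp1: "(\<Sum>c\<le>N. scale (x c) (wt (1 - 2 * int c))) = scale (x 0) (wt 1)" for x N
    by (subst sum.atMost_shift) (simp add: wt_neg)
  have "act tt vp = wt 1"
    using act_tt_wt[of 0] qq_minus_inverse by (simp add: wt_0 wt_neg qint_def)
  then show ?case
    using vp vp1 tev_1 by (simp add: tev_0 act_1 vp_in coeff_0)
next
  case (Suc m)
  have ev: "act (tev (2 * Suc m)) vp =
      (\<Sum>c\<le>N. scale (ev_coeff (int l) (int (Suc m)) c) (wt (2 * int (Suc m) - 2 * int c)))"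
    if N: "N \<ge> Suc m" for N
  proof -
    have "scale (qint (2 * int m + 2)) (act (tev (2 * Suc m)) vp) = act tt (act (tev (2 * m + 1)) vp)"
      using tt_tev_odd[of m] by (metis act_mult act_scalar act_closed vp_in mult_Suc_right add.commute)
    also have "\<dots> = act tt (\<Sum>c\<le>N. scale (odd_coeff (int l) (int m) c) (wt (2 * int m + 1 - 2 * int c)))"
      by (subst Suc[THEN conjunct2, rule_format, of N]) (use N in simp_all)
    also have "\<dots> = (\<Sum>c\<le>N. scale (qint (2 * int m + 1 + 1 - 2 * int c) * odd_coeff (int l) (int m) c +
        (case c of 0 \<Rightarrow> 0 | Suc j \<Rightarrow>
          Echeck_coeff (int l) (2 * int m + 1 - 2 * int j) * odd_coeff (int l) (int m) j))
      (wt (2 * int m + 1 + 1 - 2 * int c)))"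
      by (rule act_tt_sum_wt) (use N in simp)
    also have "\<dots> = (\<Sum>c\<le>N. scale (qint (2 * int m + 2))
        (scale (ev_coeff (int l) (int (Suc m)) c) (wt (2 * int (Suc m) - 2 * int c))))"
    proof (rule sum.cong[OF HOL.refl])
      fix c
      have "qint (2 * int m + 1 + 1 - 2 * int c) * odd_coeff (int l) (int m) c +
        (case c of 0 \<Rightarrow> 0 | Suc j \<Rightarrow>
          Echeck_coeff (int l) (2 * int m + 1 - 2 * int j) * odd_coeff (int l) (int m) j) =
        qint (2 * int m + 2) * ev_coeff (int l) (int (Suc m)) c"
      proof (cases c)
        case (Suc j)
        then show ?thesis using odd_step[of "int m" j "int l"] by (simp add: algebra_simps)
      qed (simp add: coeff_0 add.commute)
      then show "scale (qint (2 * int m + 1 + 1 - 2 * int c) * odd_coeff (int l) (int m) c +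
        (case c of 0 \<Rightarrow> 0 | Suc j \<Rightarrow>
          Echeck_coeff (int l) (2 * int m + 1 - 2 * int j) * odd_coeff (int l) (int m) j))
        (wt (2 * int m + 1 + 1 - 2 * int c)) = scale (qint (2 * int m + 2))
        (scale (ev_coeff (int l) (int (Suc m)) c) (wt (2 * int (Suc m) - 2 * int c)))"
        by (simp add: algebra_simps)
    qed
    also have "\<dots> = scale (qint (2 * int m + 2))
        (\<Sum>c\<le>N. scale (ev_coeff (int l) (int (Suc m)) c) (wt (2 * int (Suc m) - 2 * int c)))"
      by (simp only: scale_sum_right)
    finally show ?thesis
      using qint_nonzero[of "2 * int m + 2"] by (simp only: scale_cancel_left) simp
  qed
  have odd: "act (tev (2 * Suc m + 1)) vp =
      (\<Sum>c\<le>N. scale (odd_coeff (int l) (int (Suc m)) c) (wt (2 * int (Suc m) + 1 - 2 * int c)))"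
    if N: "N \<ge> Suc m" for N
  proof -
    let ?W = "\<lambda>c. wt (2 * int m + 3 - 2 * int c)"
    have "scale (qint (2 * int m + 3)) (act (tev (2 * Suc m + 1)) vp) +
        scale (qint (2 * int m + 2)) (act (tev (2 * m + 1)) vp) = act tt (act (tev (2 * Suc m)) vp)"
    proof -
      have "act (tt * tev (2 * m + 2)) vp = scale (qint (2 * int m + 3)) (act (tev (2 * m + 3)) vp) +
          scale (qint (2 * int m + 2)) (act (tev (2 * m + 1)) vp)"
        by (simp only: tt_tev_even act_add_left act_mult act_scalar act_closed vp_in)
      moreover have "2 * m + 2 = 2 * Suc m" "2 * m + 3 = 2 * Suc m + 1" by simp_all
      ultimately show ?thesis by (simp only: act_mult vp_in)
    qed
    also have "\<dots> = act tt (\<Sum>c\<le>N. scale (ev_coeff (int l) (int (Suc m)) c) (wt (2 * int (Suc m) - 2 * int c)))"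
      using ev[OF N] by simp
    also have "\<dots> = (\<Sum>c\<le>N. scale (qint (2 * int (Suc m) + 1 - 2 * int c) * ev_coeff (int l) (int (Suc m)) c +
        (case c of 0 \<Rightarrow> 0 | Suc j \<Rightarrow>
          Echeck_coeff (int l) (2 * int (Suc m) - 2 * int j) * ev_coeff (int l) (int (Suc m)) j))
      (wt (2 * int (Suc m) + 1 - 2 * int c)))"
      by (rule act_tt_sum_wt) (use N in simp)
    also have "\<dots> = (\<Sum>c\<le>N. scale (qint (2 * int m + 3) * odd_coeff (int l) (int (Suc m)) c +
        qint (2 * int m + 2) * (case c of 0 \<Rightarrow> 0 | Suc j \<Rightarrow> odd_coeff (int l) (int m) j)) (?W c))"
    proof (rule sum.cong[OF HOL.refl])
      fix c
      have "qint (2 * int (Suc m) + 1 - 2 * int c) * ev_coeff (int l) (int (Suc m)) c +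
        (case c of 0 \<Rightarrow> 0 | Suc j \<Rightarrow>
          Echeck_coeff (int l) (2 * int (Suc m) - 2 * int j) * ev_coeff (int l) (int (Suc m)) j) =
        qint (2 * int m + 3) * odd_coeff (int l) (int (Suc m)) c +
          qint (2 * int m + 2) * (case c of 0 \<Rightarrow> 0 | Suc j \<Rightarrow> odd_coeff (int l) (int m) j)"
      proof (cases c)
        case (Suc j)
        then show ?thesis using ev_step[of "int (Suc m)" j "int l"] by (simp add: algebra_simps)
      qed (simp add: coeff_0 algebra_simps)
      then show "scale (qint (2 * int (Suc m) + 1 - 2 * int c) * ev_coeff (int l) (int (Suc m)) c +
        (case c of 0 \<Rightarrow> 0 | Suc j \<Rightarrow>
          Echeck_coeff (int l) (2 * int (Suc m) - 2 * int j) * ev_coeff (int l) (int (Suc m)) j))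
        (wt (2 * int (Suc m) + 1 - 2 * int c)) =
        scale (qint (2 * int m + 3) * odd_coeff (int l) (int (Suc m)) c +
          qint (2 * int m + 2) * (case c of 0 \<Rightarrow> 0 | Suc j \<Rightarrow> odd_coeff (int l) (int m) j)) (?W c)"
        by (simp add: algebra_simps)
    qed
    also have "\<dots> = scale (qint (2 * int m + 3)) (\<Sum>c\<le>N. scale (odd_coeff (int l) (int (Suc m)) c) (?W c)) +
        scale (qint (2 * int m + 2))
          (\<Sum>c\<le>N. scale (case c of 0 \<Rightarrow> 0 | Suc j \<Rightarrow> odd_coeff (int l) (int m) j) (?W c))"
      by (simp add: scale_sum_right scale_left_distrib sum.distrib)
    also have "(\<Sum>c\<le>N. scale (case c of 0 \<Rightarrow> 0 | Suc j \<Rightarrow> odd_coeff (int l) (int m) j) (?W c)) =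
        act (tev (2 * m + 1)) vp"
      using sum_wt_shift[of "2 * int m + 3" N "odd_coeff (int l) (int m)"] N
        Suc[THEN conjunct2, rule_format, of N]
      by (simp add: algebra_simps)
    finally have "scale (qint (2 * int m + 3)) (act (tev (2 * Suc m + 1)) vp) =
        scale (qint (2 * int m + 3)) (\<Sum>c\<le>N. scale (odd_coeff (int l) (int (Suc m)) c) (?W c))"
      by simp
    then show ?thesis
      using qint_nonzero[of "2 * int m + 3"] by (simp add: algebra_simps)
  qed
  show ?case using ev odd by blast
qed

lemmas act_tev_even = act_tev_expansion[THEN conjunct1, rule_format, OF order.refl]
  and act_tev_odd = act_tev_expansion[THEN conjunct2, rule_format, OF order.refl]

text \<open>In every summand of the expansion, either the weight vector has index greater than \<open>\<mu>\<close>, or the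
  Gaussian binomial coefficient vanishes.\<close>

lemma act_tev_eq_0: assumes "n > \<mu>" shows "act (tev n) vp = 0"
proof (cases "even n")
  case True
  then obtain m where m: "n = 2 * m" by blast
  have "scale (ev_coeff (int l) (int m) c) (wt (2 * int m - 2 * int c)) = 0" for c
  proof (cases "int l - int m + int c \<ge> 0")
    case True
    then show ?thesis using assms by (simp add: ev_coeff_def gbin_eq_0 m weight)
  next
    case False
    then show ?thesis by (simp add: wt_eq_0 weight)
  qed
  then show ?thesis unfolding m act_tev_even by (intro sum.neutral ballI)
next
  case False
  then obtain m where m: "n = 2 * m + 1" by (metis oddE)
  have "scale (odd_coeff (int l) (int m) c) (wt (2 * int m + 1 - 2 * int c)) = 0" for c
  proof (cases "int l - int m - 1 + int c \<ge> 0")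
    case True
    then show ?thesis using assms by (simp add: odd_coeff_def gbin_eq_0 m weight)
  next
    case False
    then show ?thesis by (simp add: wt_eq_0 weight)
  qed
  then show ?thesis unfolding m act_tev_odd by (intro sum.neutral ballI)
qed

text \<open>The error terms that a canonical basis vector with leading term \<open>F\<^sup>(\<^sup>n\<^sup>)\<close> may have, restricted to
  indices below \<open>n\<close>.\<close>

definition lower_lattice :: "nat \<Rightarrow> 'a set" where
  "lower_lattice n = {\<Sum>r<n. scale (c r) (act (Fdiv r) vp) | c. \<forall>r. c r \<in> qinv_Zqinv}"

lemma lower_lattice_add:
  assumes "x \<in> lower_lattice n" "y \<in> lower_lattice n"
  shows "x + y \<in> lower_lattice n"
proof -
  obtain c d where "\<forall>r. c r \<in> qinv_Zqinv" "\<forall>r. d r \<in> qinv_Zqinv"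
    and xy: "x = (\<Sum>r<n. scale (c r) (act (Fdiv r) vp))" "y = (\<Sum>r<n. scale (d r) (act (Fdiv r) vp))"
    using assms unfolding lower_lattice_def by blast
  then have "\<forall>r. c r + d r \<in> qinv_Zqinv" by (simp add: qinv_Zqinv_add)
  moreover have "x + y = (\<Sum>r<n. scale (c r + d r) (act (Fdiv r) vp))"
    by (simp add: xy scale_left_distrib sum.distrib)
  ultimately show ?thesis
    unfolding lower_lattice_def by (intro CollectI exI[of _ "\<lambda>r. c r + d r"] conjI)
qed

lemma lower_lattice_single:
  assumes "d \<in> qinv_Zqinv" "r < n"
  shows "scale d (act (Fdiv r) vp) \<in> lower_lattice n"
proof -
  have "scale d (act (Fdiv r) vp) = (\<Sum>s<n. scale (if s = r then d else 0) (act (Fdiv s) vp))"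
    using assms(2) by (simp add: if_distrib[of "\<lambda>x. scale x _"] sum.delta cong: if_cong)
  then show ?thesis
    unfolding lower_lattice_def using assms(1) qinv_Zqinv_0
    by (intro CollectI exI[of _ "\<lambda>s. if s = r then d else 0"]) simp
qed

lemma lower_lattice_sum:
  "(\<And>i. i \<in> I \<Longrightarrow> f i \<in> lower_lattice n) \<Longrightarrow> finite I \<Longrightarrow> (\<Sum>i\<in>I. f i) \<in> lower_lattice n"
proof (induction I rule: infinite_finite_induct)
  case empty
  show ?case
    unfolding lower_lattice_def using qinv_Zqinv_0 by (intro CollectI exI[of _ "\<lambda>_. 0"]) simp
qed (simp_all add: lower_lattice_add)

text \<open>In the expansion, the summand \<open>c = 0\<close> is the leading term and all other coefficients lie in
  \<open>q\<^sup>-\<^sup>1\<int>[q\<^sup>-\<^sup>1]\<close>.\<close>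

lemma act_tev_unitriangular:
  assumes "n \<le> \<mu>"
  shows "act (tev n) vp - act (Fdiv n) vp \<in> lower_lattice n"
proof (cases "even n")
  case True
  then obtain m where m: "n = 2 * m" by blast
  have "act (tev n) vp - act (Fdiv n) vp =
      (\<Sum>c<m. scale (ev_coeff (int l) (int m) (Suc c)) (wt (2 * int m - 2 * int (Suc c))))"
    using wt_nat[of n] by (simp add: m act_tev_even sum.atMost_shift coeff_0)
  also have "\<dots> \<in> lower_lattice n"
  proof (intro lower_lattice_sum)
    fix c assume c: "c \<in> {..<m}"
    then have "2 * int m - 2 * int (Suc c) = int (n - 2 * Suc c)" by (simp add: m)
    then show "scale (ev_coeff (int l) (int m) (Suc c)) (wt (2 * int m - 2 * int (Suc c))) \<in> lower_lattice n"
      using assms c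
      by (simp only: wt_nat) (auto intro!: lower_lattice_single ev_coeff_qinv_Zqinv simp: m weight)
  qed simp
  finally show ?thesis .
next
  case False
  then obtain m where m: "n = 2 * m + 1" by (metis oddE)
  have "act (tev n) vp - act (Fdiv n) vp =
      (\<Sum>c<m. scale (odd_coeff (int l) (int m) (Suc c)) (wt (2 * int m + 1 - 2 * int (Suc c))))"
    unfolding m act_tev_odd using wt_nat[of "2 * m + 1"]
    by (simp add: sum.atMost_shift coeff_0 add.commute)
  also have "\<dots> \<in> lower_lattice n"
  proof (intro lower_lattice_sum)
    fix c assume c: "c \<in> {..<m}"
    then have "2 * int m + 1 - 2 * int (Suc c) = int (n - 2 * Suc c)" by (simp add: m)
    then show "scale (odd_coeff (int l) (int m) (Suc c)) (wt (2 * int m + 1 - 2 * int (Suc c))) \<in> lower_lattice n"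
      using assms c
      by (simp only: wt_nat) (auto intro!: lower_lattice_single odd_coeff_qinv_Zqinv simp: m weight)
  qed simp
  finally show ?thesis .
qed

end

section \<open>The bar involution and the canonical basis\<close>

context even_hw_module
begin

abbreviation dp :: "nat \<Rightarrow> 'a" where "dp n \<equiv> act (tev n) vp"
abbreviation fp :: "nat \<Rightarrow> 'a" where "fp n \<equiv> act (Fdiv n) vp"

lemma dp_in: "dp n \<in> V"
  by (simp add: act_closed vp_in)

lemma fp_notin_span: assumes "n \<le> \<mu>" shows "fp n \<notin> span (fp ` {..<n})"
proof -
  have "wt (int n) \<notin> span (wt ` (int ` {..<n}))"
    using wt_nonzero[OF assms] by (rule wt_notin_span) auto
  then show ?thesis by (simp add: image_image wt_nat)
qed

lemma lower_lattice_span: "lower_lattice n \<subseteq> span (fp ` {..<n})"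
  by (auto simp: lower_lattice_def intro!: span_sum span_scale intro: span_base)

lemma span_dp: "N \<le> Suc \<mu> \<Longrightarrow> span (dp ` {..<N}) = span (fp ` {..<N})"
  using act_tev_unitriangular lower_lattice_span
  by (intro unitriangular_span) (meson less_Suc_eq_le less_le_trans subsetD)

lemma span_dp_eq_V: "span (dp ` {..<Suc \<mu>}) = V"
  using span_dp[of "Suc \<mu>"] span_wt by (simp add: wt_nat)

lemma dp_notin_span: assumes "n < Suc \<mu>" shows "dp n \<notin> span (dp ` {..<n})"
proof
  assume "dp n \<in> span (dp ` {..<n})"
  then have "dp n \<in> span (fp ` {..<n})" using assms span_dp[of n] by simp
  moreover have "dp n - fp n \<in> span (fp ` {..<n})"
    using act_tev_unitriangular[of n] lower_lattice_span assms by auto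
  ultimately have "dp n - (dp n - fp n) \<in> span (fp ` {..<n})" by (rule span_diff)
  then show False using fp_notin_span[of n] assms by simp
qed

lemma dp_coeffs_unique:
  assumes "N \<le> Suc \<mu>" "(\<Sum>n<N. scale (c n) (dp n)) = (\<Sum>n<N. scale (d n) (dp n))" "n < N"
  shows "c n = d n"
proof -
  have "(\<Sum>n<N. scale (c n - d n) (dp n)) = 0"
    using assms(2) by (simp add: scale_left_diff_distrib sum_subtractf)
  then have "c n - d n = 0"
    by (rule span_chain_coeffs_zero[rotated]) (use assms dp_notin_span in auto)
  then show ?thesis by simp
qed

lemma V_dp_coeffs: assumes "x \<in> V" obtains c where "x = (\<Sum>n<Suc \<mu>. scale (c n) (dp n))"
  using assms span_dp_eq_V in_span_lessThan[of x dp "Suc \<mu>"] by blast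

lemma bar_involution_semilinear:
  assumes psi: "is_bar_involution \<psi>" and "x \<in> V"
  shows "\<psi> (scale c x) = scale (bar c) (\<psi> x)"
proof -
  have psi_in: "\<And>x. x \<in> V \<Longrightarrow> \<psi> x \<in> V"
    and psi_add: "\<And>x y. x \<in> V \<Longrightarrow> y \<in> V \<Longrightarrow> \<psi> (x + y) = \<psi> x + \<psi> y"
    and psi_rat: "\<And>c x. x \<in> V \<Longrightarrow> \<psi> (scale (Qq_of_rat c) x) = scale (Qq_of_rat c) (\<psi> x)"
    and psi_q: "\<And>x. x \<in> V \<Longrightarrow> \<psi> (scale qq x) = scale (inverse qq) (\<psi> x)"
    using psi by (auto simp: is_bar_involution_def)
  let ?S = "{c. \<forall>x\<in>V. \<psi> (scale c x) = scale (bar c) (\<psi> x)}"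
  have "c \<in> ?S"
  proof (rule Qq_generated_by_qq)
    show "Qq_of_rat c \<in> ?S" for c by (simp add: psi_rat bar_Qq_of_rat)
    show "qq \<in> ?S" by (simp add: psi_q bar_qq)
  next
    fix a b assume ab: "a \<in> ?S" "b \<in> ?S"
    then show "a + b \<in> ?S" by (simp add: scale_left_distrib psi_add scale_in bar_add)
    show "a * b \<in> ?S" using ab by (simp add: scale_in bar_mult flip: scale_scale)
    assume b: "b \<noteq> 0"
    show "a / b \<in> ?S"
    proof (intro CollectI ballI)
      fix x assume x: "x \<in> V"
      have "scale (bar b) (\<psi> (scale (a / b) x)) = \<psi> (scale b (scale (a / b) x))"
        using ab x by (simp add: scale_in del: scale_scale)
      also have "\<dots> = scale (bar a) (\<psi> x)" using ab x b by simp
      also have "\<dots> = scale (bar b) (scale (bar (a / b)) (\<psi> x))"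
        using b by (simp flip: bar_mult)
      finally show "\<psi> (scale (a / b) x) = scale (bar (a / b)) (\<psi> x)"
        using b by (simp only: scale_cancel_left bar_eq_0_iff simp_thms)
    qed
  qed
  then show ?thesis using assms(2) by simp
qed

lemma bar_involution_sum:
  assumes psi: "is_bar_involution \<psi>"
  shows "\<psi> (\<Sum>n<N. scale (c n) (dp n)) = (\<Sum>n<N. scale (bar (c n)) (dp n))"
proof (induction N)
  case 0
  show ?case using bar_involution_semilinear[OF psi vp_in, of 0] by (simp add: bar_0)
next
  case (Suc N)
  have "(\<Sum>n<N. scale (c n) (dp n)) \<in> V"
    using subspace_carrier by (intro subspace_sum) (auto intro: scale_in dp_in)
  then show ?case
    using psi Suc dp_in by (simp add: is_bar_involution_def scale_in bar_involution_semilinear[OF psi])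
qed

lemma bar_involution_unique:
  assumes "is_bar_involution \<psi>" "is_bar_involution \<phi>"
  shows "\<psi> = \<phi>"
proof (rule extensionalityI)
  show "\<psi> \<in> extensional V" "\<phi> \<in> extensional V"
    using assms by (auto simp: is_bar_involution_def PiE_def)
  fix x assume "x \<in> V"
  then show "\<psi> x = \<phi> x"
    by (elim V_dp_coeffs) (use assms in \<open>simp only: bar_involution_sum\<close>)
qed

text \<open>The divided powers up to degree \<open>\<mu>\<close> give a basis; applying the bar automorphism to coordinates
  fixes it.  The divided powers of higher degree are fixed because they give zero.\<close>

lemma bar_involution_exists: "\<exists>\<psi>. is_bar_involution \<psi>"
proof -
  \<comment> \<open>The coordinates of \<open>x\<close> with respect to the divided powers.\<close>
  define co where "co x = (SOME c. x = (\<Sum>n<Suc \<mu>. scale (c n) (dp n)))" for x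
  define \<psi> where "\<psi> x = (if x \<in> V then \<Sum>n<Suc \<mu>. scale (bar (co x n)) (dp n) else undefined)" for x
  have co: "x = (\<Sum>n<Suc \<mu>. scale (co x n) (dp n))" if "x \<in> V" for x
    using someI_ex[of "\<lambda>c. x = (\<Sum>n<Suc \<mu>. scale (c n) (dp n))"] V_dp_coeffs[OF that]
    unfolding co_def by metis
  have sum_in: "(\<Sum>n<Suc \<mu>. scale (c n) (dp n)) \<in> V" for c
    using subspace_carrier by (intro subspace_sum) (auto intro: scale_in dp_in)
  have psi: "\<psi> x = (\<Sum>n<Suc \<mu>. scale (bar (c n)) (dp n))"
    if x: "x = (\<Sum>n<Suc \<mu>. scale (c n) (dp n))" for x c
  proof -
    have "co x n = c n" if "n < Suc \<mu>" for n
      by (rule dp_coeffs_unique[of "Suc \<mu>"]) (use co[of x] sum_in x that in \<open>simp_all only:\<close>)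
    then show ?thesis using sum_in[of c] x by (simp add: \<psi>_def del: sum.lessThan_Suc)
  qed
  have scale: "\<psi> (scale a x) = scale (bar a) (\<psi> x)" if "x \<in> V" for a x
  proof -
    have "scale a x = (\<Sum>n<Suc \<mu>. scale (a * co x n) (dp n))"
      by (subst co[OF that]) (simp add: scale_sum_right del: sum.lessThan_Suc)
    then show ?thesis
      by (simp add: psi psi[OF co[OF that]] bar_mult scale_sum_right del: sum.lessThan_Suc)
  qed
  have "is_bar_involution \<psi>"
    unfolding is_bar_involution_def
  proof (intro conjI ballI allI)
    show "\<psi> \<in> V \<rightarrow>\<^sub>E V" using sum_in by (auto simp: \<psi>_def simp del: sum.lessThan_Suc)
  next
    fix x y assume xy: "x \<in> V" "y \<in> V"
    have "x + y = (\<Sum>n<Suc \<mu>. scale (co x n + co y n) (dp n))"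
      by (subst co[OF xy(1)], subst co[OF xy(2)])
        (simp add: scale_left_distrib sum.distrib del: sum.lessThan_Suc)
    from psi[OF this] show "\<psi> (x + y) = \<psi> x + \<psi> y"
      by (simp add: psi[OF co[OF xy(1)]] psi[OF co[OF xy(2)]] bar_add scale_left_distrib
          sum.distrib del: sum.lessThan_Suc)
  next
    fix n
    show "\<psi> (dp n) = dp n"
    proof (cases "n \<le> \<mu>")
      case True
      have "dp n = (\<Sum>k<Suc \<mu>. scale (if k = n then 1 else 0) (dp k))"
        using True by (simp add: if_distrib[of "\<lambda>x. scale x _"] sum.delta less_Suc_eq_le
            cong: if_cong del: sum.lessThan_Suc)
      from psi[OF this] show ?thesis
        using True by (simp add: if_distrib[of "\<lambda>x. scale x _"] if_distrib[of bar] bar_0 bar_1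
            sum.delta less_Suc_eq_le cong: if_cong del: sum.lessThan_Suc)
    next
      case False
      then have "dp n = 0" by (simp add: act_tev_eq_0)
      then show ?thesis using psi[of 0 "\<lambda>_. 0"] by (simp add: bar_0)
    qed
  qed (simp_all add: scale bar_Qq_of_rat bar_qq)
  then show ?thesis by (intro exI[of is_bar_involution \<psi>])
qed

lemma is_bar_involution_bar_involution: "is_bar_involution bar_involution"
proof -
  obtain \<psi> where psi: "is_bar_involution \<psi>" using bar_involution_exists by blast
  have "bar_involution = \<psi>"
    unfolding bar_involution_def
    by (rule the_equality) (use psi bar_involution_unique in auto)
  with psi show ?thesis by simp
qed

text \<open>A bar invariant vector in the \<open>q\<^sup>-\<^sup>1\<int>[q\<^sup>-\<^sup>1]\<close>-span of the \<open>F\<^sup>(\<^sup>r\<^sup>)\<close> has, by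
  unitriangularity, the same top coefficient with respect to the \<open>F\<^sup>(\<^sup>r\<^sup>)\<close> and to the divided powers.  The
  latter are bar invariant, so this coefficient is fixed by the bar automorphism, hence zero.\<close>

lemma bar_fixed_lattice_zero:
  assumes "N \<le> Suc \<mu>" "\<And>r. r < N \<Longrightarrow> d r \<in> qinv_Zqinv"
    and "bar_involution (\<Sum>r<N. scale (d r) (fp r)) = (\<Sum>r<N. scale (d r) (fp r))"
  shows "(\<Sum>r<N. scale (d r) (fp r)) = 0"
  using assms
proof (induction N)
  case (Suc N)
  let ?x = "\<Sum>r<Suc N. scale (d r) (fp r)"
  have lower: "(\<Sum>r<N. scale (e r) (f r)) \<in> span (f ` {..<N})" for e and f :: "nat \<Rightarrow> 'a"
    by (auto intro!: span_sum span_scale intro: span_base)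
  have "?x \<in> span (fp ` {..<Suc N})"
    by (intro span_sum span_scale span_base) auto
  then have "?x \<in> span (dp ` {..<Suc N})" using Suc.prems(1) span_dp by simp
  then obtain e where e: "?x = (\<Sum>n<Suc N. scale (e n) (dp n))" by (metis in_span_lessThan)
  have "e N = d N"
  proof (rule ccontr)
    assume "e N \<noteq> d N"
    have tri: "dp N - fp N \<in> span (fp ` {..<N})"
      using act_tev_unitriangular[of N] lower_lattice_span Suc.prems(1) by auto
    have "scale (e N - d N) (fp N) = (\<Sum>r<N. scale (d r) (fp r)) - (\<Sum>n<N. scale (e n) (dp n)) -
        scale (e N) (dp N - fp N)"
      using e by (simp add: scale_left_diff_distrib scale_right_diff_distrib algebra_simps)
    also have "\<dots> \<in> span (fp ` {..<N})"
      using lower[of d fp] lower[of e dp] span_dp[of N] Suc.prems(1) tri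
      by (auto intro!: span_diff span_scale)
    finally have "scale (inverse (e N - d N)) (scale (e N - d N) (fp N)) \<in> span (fp ` {..<N})"
      by (rule span_scale)
    then show False using fp_notin_span[of N] Suc.prems(1) \<open>e N \<noteq> d N\<close> by simp
  qed
  moreover have "bar (e N) = e N"
  proof (rule dp_coeffs_unique[of "Suc N" "\<lambda>n. bar (e n)"])
    show "(\<Sum>n<Suc N. scale (bar (e n)) (dp n)) = (\<Sum>n<Suc N. scale (e n) (dp n))"
      using Suc.prems(3) unfolding e bar_involution_sum[OF is_bar_involution_bar_involution] .
  qed (use Suc.prems in auto)
  ultimately have "d N = 0"
    using Suc.prems(2)[of N] bar_fixed_qinv_Zqinv by simp
  then show ?case using Suc by simp
qed simp

lemma is_icanonical_basis_dp: "is_icanonical_basis (restrict dp {..\<mu>})"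
  unfolding is_icanonical_basis_def
proof (intro conjI allI impI)
  have eq: "restrict dp {..\<mu>} ` {..\<mu>} = dp ` {..<Suc \<mu>}" by (auto simp: less_Suc_eq_le)
  have ind: "independent (dp ` {..<Suc \<mu>}) \<and> inj_on dp {..<Suc \<mu>}"
    by (rule span_chain_independent) (rule dp_notin_span)
  show "restrict dp {..\<mu>} \<in> {..\<mu>} \<rightarrow>\<^sub>E V" by (simp add: dp_in)
  show "inj_on (restrict dp {..\<mu>}) {..\<mu>}"
    using ind by (simp add: inj_on_def less_Suc_eq_le)
  show "independent (restrict dp {..\<mu>} ` {..\<mu>})" unfolding eq using ind by simp
  show "span (restrict dp {..\<mu>} ` {..\<mu>}) = V" unfolding eq by (rule span_dp_eq_V)
next
  fix a assume a: "a \<le> \<mu>"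
  show "bar_involution (restrict dp {..\<mu>} a) = restrict dp {..\<mu>} a"
    using a is_bar_involution_bar_involution by (simp add: is_bar_involution_def)
  obtain c where c: "\<forall>r. c r \<in> qinv_Zqinv" "dp a - fp a = (\<Sum>r<a. scale (c r) (fp r))"
    using act_tev_unitriangular[OF a] unfolding lower_lattice_def by blast
  have "(\<Sum>r\<le>\<mu>. scale (if r < a then c r else 0) (fp r)) = (\<Sum>r<a. scale (c r) (fp r))"
    by (rule sum.mono_neutral_cong_right) (use a in auto)
  then have "restrict dp {..\<mu>} a = fp a + (\<Sum>r\<le>\<mu>. scale (if r < a then c r else 0) (fp r))"
    using c(2) a by (simp add: diff_eq_eq add.commute)
  moreover have "\<forall>r\<le>\<mu>. (if r < a then c r else 0) \<in> qinv_Zqinv"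
    using c(1) qinv_Zqinv_0 by simp
  ultimately show "\<exists>c. (\<forall>r\<le>\<mu>. c r \<in> qinv_Zqinv) \<and>
      restrict dp {..\<mu>} a = fp a + (\<Sum>r\<le>\<mu>. scale (c r) (fp r))"
    by (intro exI[of _ "\<lambda>r. if r < a then c r else 0"] conjI)
qed

text \<open>The difference of two candidates for the same index is bar invariant, and its coefficients lie in
  \<open>q\<^sup>-\<^sup>1\<int>[q\<^sup>-\<^sup>1]\<close> because the leading terms cancel.\<close>

lemma is_icanonical_basis_unique:
  assumes b: "is_icanonical_basis b" and b': "is_icanonical_basis b'"
  shows "b = b'"
proof (rule extensionalityI)
  show "b \<in> extensional {..\<mu>}" "b' \<in> extensional {..\<mu>}"
    using b b' by (auto simp: is_icanonical_basis_def PiE_def)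
  fix a assume "a \<in> {..\<mu>}"
  then have a: "a \<le> \<mu>" by simp
  obtain c where c: "\<forall>r\<le>\<mu>. c r \<in> qinv_Zqinv" "b a = fp a + (\<Sum>r\<le>\<mu>. scale (c r) (fp r))"
    using b a unfolding is_icanonical_basis_def by blast
  obtain c' where c': "\<forall>r\<le>\<mu>. c' r \<in> qinv_Zqinv" "b' a = fp a + (\<Sum>r\<le>\<mu>. scale (c' r) (fp r))"
    using b' a unfolding is_icanonical_basis_def by blast
  have diff: "b a - b' a = (\<Sum>r<Suc \<mu>. scale (c r - c' r) (fp r))"
    by (simp add: c c' scale_left_diff_distrib sum_subtractf lessThan_Suc_atMost)
  have psi: "is_bar_involution bar_involution" by (rule is_bar_involution_bar_involution)
  have in_V: "b a \<in> V" "b' a \<in> V" using b b' a by (auto simp: is_icanonical_basis_def)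
  then have minus: "b a - b' a = b a + scale (- 1) (b' a)" by simp
  \<comment> \<open>A bar involution is semilinear, so subtraction is treated as adding a multiple by \<open>- 1\<close>.\<close>
  have "bar (- 1) = - 1" using bar_add[of 1 "- 1"] by (simp add: bar_0 bar_1 add_eq_0_iff)
  then have "bar_involution (b a - b' a) = b a - b' a"
    unfolding minus using in_V psi bar_involution_semilinear[OF psi in_V(2), of "- 1"] b b' a
    by (simp add: is_bar_involution_def is_icanonical_basis_def scale_in del: scale_minus_left)
  then have "b a - b' a = 0"
    unfolding diff
    by (rule bar_fixed_lattice_zero[rotated 2]) (use c c' in \<open>auto simp: qinv_Zqinv_diff\<close>)
  then show "b a = b' a" by simp
qed

lemma icanonical_basis_eq: "icanonical_basis = restrict dp {..\<mu>}"
  unfolding icanonical_basis_def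
  by (rule the_equality) (use is_icanonical_basis_dp is_icanonical_basis_unique in auto)

text \<open>An element of the coideal subalgebra is determined by its action on the highest weight vector of a
  sufficiently large module.\<close>

lemma tev_combination_faithful:
  assumes "N \<le> Suc \<mu>" "act (\<Sum>n<N. scalar (c n) * tev n) vp = 0" "n < N"
  shows "c n = 0"
proof -
  have "(\<Sum>n<N. scale (c n) (dp n)) = 0"
    using assms(2) by (simp add: act_sum_left vp_in act_mult act_scalar dp_in)
  then show ?thesis
    by (rule span_chain_coeffs_zero[rotated]) (use assms dp_notin_span in auto)
qed

end

section \<open>The canonical basis of the coideal subalgebra\<close>

lemma one_in_Ui: "1 \<in> Ui"
  using Ui.scalar[of 1] by (simp add: scalar_hom)

lemma diff_in_Ui: "x \<in> Ui \<Longrightarrow> y \<in> Ui \<Longrightarrow> x - y \<in> Ui"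
  using Ui.add[OF _ Ui.mult[OF Ui.scalar[of "- 1"]], of x y] by (simp add: scalar_minus scalar_hom)

lemma tev_in_Ui: "tev n \<in> Ui"
proof -
  have "(\<Prod>i\<leftarrow>xs. tt - scalar (qint (2 * i))) \<in> Ui" for xs
    by (induction xs) (auto intro: one_in_Ui diff_in_Ui Ui.intros)
  then show ?thesis
    by (auto simp: tev_def tt_prod_def Let_def intro!: one_in_Ui Ui.intros)
qed

interpretation Uq: vector_space "\<lambda>c u. scalar c * u :: Uq"
  by unfold_locales (simp_all add: scalar_hom algebra_simps)

text \<open>By the recursion, the span of the divided powers is closed under multiplication by \<open>tt\<close>; it also
  contains \<open>1 = tev 0\<close>.\<close>

lemma Ui_subset_span_tev: "Ui \<subseteq> Uq.span (range tev)"
proof -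
  have tt: "tt * y \<in> Uq.span (range tev)" if "y \<in> Uq.span (range tev)" for y
    using that
  proof (induction rule: Uq.span_induct)
    case base
    show ?case
    proof -
      have "tt * (scalar c * x) = scalar c * (tt * x)" for c x
        by (metis mult.assoc scalar_commute)
      then show ?thesis
        by (intro Uq.subspaceI) (simp_all add: ring_distribs Uq.span_zero Uq.span_add Uq.span_scale)
    qed
  next
    case (step y)
    then obtain n where y: "y = tev n" by blast
    consider "n = 0" | a where "n = 2 * a + 1" | a where "n = 2 * a + 2"
      by (metis oddE evenE add_2_eq_Suc' mult_Suc_right not0_implies_Suc add.commute mult_0_right)
    then show ?case
    proof cases
      case 1
      then show ?thesis by (metis y tev_0 tev_1 mult_1_right Uq.span_base rangeI)
    next
      case 2
      show ?thesis unfolding y 2 tt_tev_odd by (intro Uq.span_scale Uq.span_base) blast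
    next
      case 3
      show ?thesis unfolding y 3 tt_tev_even
        by (intro Uq.span_add Uq.span_scale Uq.span_base) blast+
    qed
  qed
  have "x * y \<in> Uq.span (range tev)" if "x \<in> Ui" "y \<in> Uq.span (range tev)" for x y
    using that
  proof (induction arbitrary: y rule: Ui.induct)
    case (scalar c) then show ?case by (rule Uq.span_scale)
  qed (simp_all add: tt ring_distribs Uq.span_add mult.assoc)
  moreover have "1 \<in> Uq.span (range tev)"
    using tev_0 by (metis Uq.span_base rangeI)
  ultimately show ?thesis by (metis mult_1_right subsetI)
qed

lemma Ui_eq_tev_combination:
  assumes "u \<in> Ui"
  obtains N c where "u = (\<Sum>n<N. scalar (c n) * tev n)"
proof -
  have "u \<in> Uq.span (range tev)" using assms Ui_subset_span_tev by blast
  then have "\<exists>N. u \<in> Uq.span (tev ` {..<N})"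
  proof (induction rule: Uq.span_induct_alt)
    case base
    show ?case by (blast intro: Uq.span_zero)
  next
    case (step c x y)
    then obtain n N where "x = tev n" "y \<in> Uq.span (tev ` {..<N})" by blast
    moreover have "Uq.span (tev ` {..<N}) \<subseteq> Uq.span (tev ` {..<max N (Suc n)})"
      by (rule Uq.span_mono) auto
    moreover have "tev n \<in> Uq.span (tev ` {..<max N (Suc n)})"
      by (rule Uq.span_base) simp
    ultimately have "scalar c * x + y \<in> Uq.span (tev ` {..<max N (Suc n)})"
      by (blast intro: Uq.span_add Uq.span_scale)
    then show ?case by blast
  qed
  then show ?thesis using that Uq.in_span_lessThan by blast
qed

theorem theorem2p10:
  fixes scale :: "Qq \<Rightarrow> 'v::ab_group_add \<Rightarrow> 'v"
    and V :: "nat \<Rightarrow> 'v set"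
    and act :: "nat \<Rightarrow> Uq \<Rightarrow> 'v \<Rightarrow> 'v"
    and vp :: "nat \<Rightarrow> 'v"
  assumes L: "\<And>\<mu>. simple_hw_module scale (V \<mu>) (act \<mu>) \<mu> (vp \<mu>)"
  shows "(\<forall>l.
      (\<lambda>n. act (2 * l) (tev n) (vp (2 * l))) ` {0..2 * l} =
        simple_hw_module.icanonical_basis scale (V (2 * l)) (act (2 * l)) (2 * l) (vp (2 * l))
          ` {0..2 * l} \<and>
      (\<forall>n>2 * l. act (2 * l) (tev n) (vp (2 * l)) = 0)) \<and>
    range tev = range (Ui_icanonical_basis scale V act vp)"
proof
  have M: "even_hw_module scale (V (2 * l)) (act (2 * l)) (2 * l) (vp (2 * l)) l" for l
    using L[of "2 * l"] by (simp add: even_hw_module_def even_hw_module_axioms_def)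
  have icb: "simple_hw_module.icanonical_basis scale (V (2 * l)) (act (2 * l)) (2 * l) (vp (2 * l)) n =
      act (2 * l) (tev n) (vp (2 * l))" if "n \<le> 2 * l" for l n
    using even_hw_module.icanonical_basis_eq[OF M] that by simp
  show "\<forall>l.
      (\<lambda>n. act (2 * l) (tev n) (vp (2 * l))) ` {0..2 * l} =
        simple_hw_module.icanonical_basis scale (V (2 * l)) (act (2 * l)) (2 * l) (vp (2 * l))
          ` {0..2 * l} \<and>
      (\<forall>n>2 * l. act (2 * l) (tev n) (vp (2 * l)) = 0)"
    using even_hw_module.act_tev_eq_0[OF M] icb by (auto intro!: image_cong)
  have "Ui_icanonical_basis scale V act vp a = tev a" for a
    unfolding Ui_icanonical_basis_def
  proof (rule the_equality, intro conjI)
    show "tev a \<in> Ui" by (rule tev_in_Ui)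
    show "\<forall>\<^sub>F l in sequentially. act (2 * l) (tev a) (vp (2 * l)) =
        simple_hw_module.icanonical_basis scale (V (2 * l)) (act (2 * l)) (2 * l) (vp (2 * l)) a"
      using eventually_ge_at_top[of a] by eventually_elim (simp add: icb)
  next
    fix u
    assume u: "u \<in> Ui \<and> (\<forall>\<^sub>F l in sequentially. act (2 * l) u (vp (2 * l)) =
        simple_hw_module.icanonical_basis scale (V (2 * l)) (act (2 * l)) (2 * l) (vp (2 * l)) a)"
    then have "u - tev a \<in> Ui" by (simp add: diff_in_Ui tev_in_Ui)
    then obtain N c where c: "u - tev a = (\<Sum>n<N. scalar (c n) * tev n)"
      by (rule Ui_eq_tev_combination)
    have "\<forall>\<^sub>F l in sequentially. act (2 * l) u (vp (2 * l)) =
        simple_hw_module.icanonical_basis scale (V (2 * l)) (act (2 * l)) (2 * l) (vp (2 * l)) a \<and>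
        a \<le> l \<and> N \<le> l"
      using u by (auto intro!: eventually_conj eventually_ge_at_top)
    then obtain l where l: "act (2 * l) u (vp (2 * l)) =
        simple_hw_module.icanonical_basis scale (V (2 * l)) (act (2 * l)) (2 * l) (vp (2 * l)) a"
        "a \<le> l" "N \<le> l"
      unfolding eventually_sequentially by auto
    \<comment> \<open>The highest weight \<open>2 * l\<close> is at least the degree of every divided power that occurs in
      \<open>u - tev a\<close>, so these act on the highest weight vector by linearly independent vectors.\<close>
    interpret even_hw_module scale "V (2 * l)" "act (2 * l)" "2 * l" "vp (2 * l)" l by (rule M)
    have "act (2 * l) (u - tev a) (vp (2 * l)) = 0"
      using l by (simp add: act_diff_left vp_in icb)
    then have "c n = 0" if "n < N" for n
      unfolding c by (rule tev_combination_faithful[rotated]) (use l that in auto)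
    then have "u - tev a = 0" unfolding c by (simp add: scalar_hom)
    then show "u = tev a" by simp
  qed
  then show "range tev = range (Ui_icanonical_basis scale V act vp)" by simp
qed

end
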